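(* Let $S$ be a finite inverse semigroup with $\mathcal D$-classes $D_0,\dots,D_n$; for each $j$ let $r_j$ be the number of idempotents in $D_j$ and let $G_j$ be the maximal subgroup of $S$ at a chosen idempotent $e_j\in D_j$. Let $\mathcal X$ be any complete set of inequivalent, irreducible matrix representations of $\mathbb C S$. Let $g=\sum_{s\in S}g(s)\lfloor s\rfloor\in\mathbb C S$ and let $s\in D_k$. Then \[ g(s)=\frac1{r_k|G_k|}\sum_{\rho\in\mathcal X}d_\rho\,\mathrm{trace}\!\left(\hat g(\rho)\,\rho(\lfloor s^{-1}\rfloor)\right). \]
   Context: An inverse semigroup is a semigroup $S$ in which each $x$ has a unique $x^{-1}$ with $xx^{-1}x=x$, $x^{-1}xx^{-1}=x^{-1}$. Write $\mathrm{dom}(s)=s^{-1}s$, $\mathrm{ran}(s)=ss^{-1}$. Natural partial order: $t\leq s$ iff $t=es$ for some idempotent $e$; $\mu$ is its M\"obius function. $s\mathrel{\mathcal D}t$ iff there is $x\in S$ with $\mathrm{dom}(x)=\mathrm{ran}(s)$, $\mathrm{ran}(x)=\mathrm{ran}(t)$ (an equivalence relation with classes the $\mathcal D$-classes). The maximal subgroup at an idempotent $e$ is $\{s\in S:\mathrm{dom}(s)=\mathrm{ran}(s)=e\}$. Groupoid basis: $\lfloor s\rfloor=\sum_{t\leq s}\mu(t,s)t$ for $s\in S$; these form a basis of the semigroup algebra $\mathbb C S$. A representation is an algebra homomorphism $\rho:\mathbb C S\to M_{d_\rho}(\mathbb C)$, of dimension $d_\rho$; a complete set of inequivalent irreducible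 representations contains exactly one representative of each equivalence class of irreducible representations. For $g\in\mathbb C S$, $\hat g(\rho)=\rho(g)$. *)

theory Defs
  imports Complex_Main "Jordan_Normal_Form.VS_Connect"
begin

section \<open>Inverse semigroups\<close>

class inverse_semigroup = semigroup_mult +
  assumes ex1_sg_inv: "\<exists>!y. x * y * x = x \<and> y * x * y = y"

definition sg_inv :: "'a::inverse_semigroup \<Rightarrow> 'a" where
  "sg_inv x = (THE y. x * y * x = x \<and> y * x * y = y)"

definition sg_dom :: "'a::inverse_semigroup \<Rightarrow> 'a" where
  "sg_dom s = sg_inv s * s"

definition sg_ran :: "'a::inverse_semigroup \<Rightarrow> 'a" where
  "sg_ran s = s * sg_inv s"

definition idem :: "'a::semigroup_mult \<Rightarrow> bool" where
  "idem e \<longleftrightarrow> e * e = e"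

definition nat_le :: "'a::inverse_semigroup \<Rightarrow> 'a \<Rightarrow> bool" where
  "nat_le t s \<longleftrightarrow> (\<exists>e. idem e \<and> t = e * s)"

definition D_rel :: "('a::inverse_semigroup \<times> 'a) set" where
  "D_rel = {(s, t). \<exists>x. sg_dom x = sg_ran s \<and> sg_ran x = sg_ran t}"

definition maximal_subgroup :: "'a::inverse_semigroup \<Rightarrow> 'a set" where
  "maximal_subgroup e = {s. sg_dom s = e \<and> sg_ran s = e}"

lemma sg_inv:
  fixes x :: "'a::inverse_semigroup"
  shows "x * sg_inv x * x = x" "sg_inv x * x * sg_inv x = sg_inv x"
  using theI'[OF ex1_sg_inv[of x]] unfolding sg_inv_def by blast+

lemma sg_inv_unique:
  fixes x y :: "'a::inverse_semigroup"
  assumes "x * y * x = x" "y * x * y = y"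
  shows "sg_inv x = y"
  using ex1_sg_inv[of x] sg_inv[of x] assms by blast

lemma idem_mult:
  fixes e f :: "'a::inverse_semigroup"
  assumes e: "idem e" and f: "idem f"
  shows "idem (e * f)"
proof -
  have ee: "e * (e * z) = e * z" and ff: "f * (f * z) = f * z" for z
    using e f by (simp_all add: idem_def mult.assoc[symmetric])
  define x where "x = sg_inv (e * f)"
  have x1: "e * (f * (x * (e * f))) = e * f" and x2: "x * (e * (f * x)) = x"
    using sg_inv[of "e * f"] unfolding x_def by (simp_all add: mult.assoc)
  have x2': "x * (e * (f * (x * z))) = x * z" for z
    using arg_cong[OF x2, of "\<lambda>w. w * z"] by (simp add: mult.assoc)
  have "x = f * x * e"
    unfolding x_def
    by (rule sg_inv_unique)
      (simp_all add: mult.assoc ee ff x1[unfolded x_def] x2'[unfolded x_def])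
  then have fx: "f * (x * e) = x" by (simp add: mult.assoc)
  have xx: "x * x = x"
    using x2'[of e] fx by (metis mult.assoc)
  then have "sg_inv x = x" by (intro sg_inv_unique) simp_all
  moreover have "sg_inv x = e * f"
    by (rule sg_inv_unique) (simp_all add: mult.assoc x1 x2)
  ultimately show ?thesis using xx by (simp add: idem_def)
qed

lemma idem_commute:
  fixes e f :: "'a::inverse_semigroup"
  assumes e: "idem e" and f: "idem f"
  shows "e * f = f * e"
proof -
  have ee: "e * (e * z) = e * z" and ff: "f * (f * z) = f * z" for z
    using e f by (simp_all add: idem_def mult.assoc[symmetric])
  have ef: "e * (f * (e * f)) = e * f" and fe: "f * (e * (f * e)) = f * e"
    using idem_mult[OF e f] idem_mult[OF f e] by (simp_all add: idem_def mult.assoc)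
  have "sg_inv (e * f) = f * e"
    by (rule sg_inv_unique) (simp_all add: mult.assoc ee ff ef fe)
  moreover have "sg_inv (e * f) = e * f"
    by (rule sg_inv_unique) (simp_all add: mult.assoc ef)
  ultimately show ?thesis by simp
qed

lemma nat_le_partial_order:
  fixes x y z :: "'a::inverse_semigroup"
  shows "nat_le x x"
    and "nat_le x y \<Longrightarrow> nat_le y x \<Longrightarrow> x = y"
    and "nat_le x y \<Longrightarrow> nat_le y z \<Longrightarrow> nat_le x z"
proof -
  have "idem (x * sg_inv x)" "x = x * sg_inv x * x"
    using sg_inv[of x] by (simp_all add: idem_def mult.assoc[symmetric])
  then show "nat_le x x" unfolding nat_le_def by blast
next
  assume "nat_le x y" "nat_le y x"
  then obtain e f where e: "idem e" "x = e * y" and f: "idem f" "y = f * x"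
    unfolding nat_le_def by blast
  have "e * x = x" "f * y = y"
    using e f by (metis idem_def mult.assoc)+
  then show "x = y"
    using e f idem_commute[of e f] by (metis mult.assoc)
next
  assume "nat_le x y" "nat_le y z"
  then show "nat_le x z"
    unfolding nat_le_def using idem_mult mult.assoc by metis
qed


section \<open>The Moebius function of a finite poset\<close>

text \<open>The inverse of the zeta function in the incidence algebra, extended by \<open>0\<close> to
  pairs that are not comparable. The defining equations determine it for every partial
  order on a finite type (lemma \<open>moebius_ex1\<close>), so in particular for the natural partial order.\<close>

definition moebius :: "('a::finite \<Rightarrow> 'a \<Rightarrow> bool) \<Rightarrow> 'a \<Rightarrow> 'a \<Rightarrow> int" where
  "moebius leq = (THE \<mu>. \<forall>x y.
     (leq x y \<longrightarrow> (\<Sum>z | leq x z \<and> leq z y. \<mu> x z) = (if x = y then 1 else 0)) \<and>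
     (\<not> leq x y \<longrightarrow> \<mu> x y = 0))"

lemma moebius_ex1:
  fixes leq :: "'a::finite \<Rightarrow> 'a \<Rightarrow> bool"
  assumes po: "\<And>x. leq x x" "\<And>x y. leq x y \<Longrightarrow> leq y x \<Longrightarrow> x = y"
    "\<And>x y z. leq x y \<Longrightarrow> leq y z \<Longrightarrow> leq x z"
  shows "\<exists>!\<mu> :: 'a \<Rightarrow> 'a \<Rightarrow> int. \<forall>x y.
     (leq x y \<longrightarrow> (\<Sum>z | leq x z \<and> leq z y. \<mu> x z) = (if x = y then 1 else 0)) \<and>
     (\<not> leq x y \<longrightarrow> \<mu> x y = 0)"
proof -
  define R where "R = {(z, y). leq z y \<and> z \<noteq> y}"
  have "trans R" "irrefl R"
    using po unfolding R_def trans_def irrefl_def by blast+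
  then have "acyclic R"
    by (simp add: acyclic_irrefl)
  then have wf: "wf R"
    by (simp add: finite_acyclic_wf)
  have split: "(\<Sum>z | leq x z \<and> leq z y. \<mu> x z) = \<mu> x y + (\<Sum>z | leq x z \<and> leq z y \<and> z \<noteq> y. \<mu> x z)"
    if "leq x y" for x y and \<mu> :: "'a \<Rightarrow> 'a \<Rightarrow> int"
  proof -
    have "{z. leq x z \<and> leq z y} = insert y {z. leq x z \<and> leq z y \<and> z \<noteq> y}"
      using that po(1) by blast
    then show ?thesis by simp
  qed
  define H where "H = (\<lambda>x (f::'a \<Rightarrow> int) y. if leq x y then (if x = y then 1 else 0)
      - (\<Sum>z | leq x z \<and> leq z y \<and> z \<noteq> y. f z) else 0)"
  define m where "m = (\<lambda>x. wfrec R (H x))"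
  have m: "m x y = H x (m x) y" for x y
  proof -
    have "m x y = H x (cut (m x) R y) y"
      unfolding m_def by (rule wfrec[OF wf])
    also have "\<dots> = H x (m x) y"
      unfolding H_def by (auto intro!: sum.cong simp: cut_apply R_def)
    finally show ?thesis .
  qed
  show ?thesis
  proof (rule ex1I[of _ m])
    show "\<forall>x y. (leq x y \<longrightarrow> (\<Sum>z | leq x z \<and> leq z y. m x z) = (if x = y then 1 else 0)) \<and>
     (\<not> leq x y \<longrightarrow> m x y = 0)"
    proof (intro allI conjI impI)
      fix x y assume "leq x y"
      then show "(\<Sum>z | leq x z \<and> leq z y. m x z) = (if x = y then 1 else 0)"
        using split[of x y m] m[of x y] by (simp add: H_def)
    next
      fix x y assume "\<not> leq x y"
      then show "m x y = 0" using m[of x y] by (simp add: H_def)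
    qed
  next
    fix \<mu> :: "'a \<Rightarrow> 'a \<Rightarrow> int"
    assume a: "\<forall>x y. (leq x y \<longrightarrow> (\<Sum>z | leq x z \<and> leq z y. \<mu> x z) = (if x = y then 1 else 0)) \<and>
     (\<not> leq x y \<longrightarrow> \<mu> x y = 0)"
    have "\<mu> x y = m x y" for x y
    proof (induction y rule: wf_induct_rule[OF wf])
      case (1 y)
      show ?case
      proof (cases "leq x y")
        case True
        have "(\<Sum>z | leq x z \<and> leq z y \<and> z \<noteq> y. \<mu> x z) = (\<Sum>z | leq x z \<and> leq z y \<and> z \<noteq> y. m x z)"
          using 1 by (intro sum.cong) (auto simp: R_def)
        moreover have "(\<Sum>z | leq x z \<and> leq z y. \<mu> x z) = (if x = y then 1 else 0)"
          using a True by blast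
        ultimately show ?thesis
          using True m[of x y] split[of x y \<mu>] by (simp add: H_def)
      next
        case False
        then show ?thesis using a m[of x y] by (simp add: H_def)
      qed
    qed
    then show "\<mu> = m" by blast
  qed
qed


section \<open>The semigroup algebra\<close>

text \<open>An element of the complex semigroup algebra of a finite semigroup is represented by
  its coefficient function with respect to the basis of semigroup elements; addition and
  scalar multiplication are pointwise and multiplication is convolution.\<close>

definition sga_add :: "('a \<Rightarrow> complex) \<Rightarrow> ('a \<Rightarrow> complex) \<Rightarrow> 'a \<Rightarrow> complex" where
  "sga_add f h = (\<lambda>u. f u + h u)"

definition sga_scale :: "complex \<Rightarrow> ('a \<Rightarrow> complex) \<Rightarrow> 'a \<Rightarrow> complex" where
  "sga_scale c f = (\<lambda>u. c * f u)"

definition sga_mult :: "('a::{finite, semigroup_mult} \<Rightarrow> complex) \<Rightarrow> ('a \<Rightarrow> complex) \<Rightarrow> 'a \<Rightarrow> complex" where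
  "sga_mult f h = (\<lambda>u. \<Sum>(s, t) | s * t = u. f s * h t)"

definition groupoid_basis :: "'a::{finite, inverse_semigroup} \<Rightarrow> 'a \<Rightarrow> complex" where
  "groupoid_basis s = (\<lambda>u. \<Sum>t | nat_le t s. of_int (moebius nat_le t s) * (if u = t then 1 else 0))"


section \<open>Matrix representations\<close>

definition mat_trace :: "complex mat \<Rightarrow> complex" where
  "mat_trace A = (\<Sum>i<dim_row A. A $$ (i, i))"

type_synonym 'a rep = "('a \<Rightarrow> complex) \<Rightarrow> complex mat"

definition rep_dim :: "'a rep \<Rightarrow> nat" where
  "rep_dim \<rho> = dim_row (\<rho> (\<lambda>_. 0))"

definition representation :: "'a::{finite, semigroup_mult} rep \<Rightarrow> bool" where
  "representation \<rho> \<longleftrightarrow>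
     (\<forall>f. \<rho> f \<in> carrier_mat (rep_dim \<rho>) (rep_dim \<rho>)) \<and>
     (\<forall>f h. \<rho> (sga_add f h) = \<rho> f + \<rho> h) \<and>
     (\<forall>c f. \<rho> (sga_scale c f) = c \<cdot>\<^sub>m \<rho> f) \<and>
     (\<forall>f h. \<rho> (sga_mult f h) = \<rho> f * \<rho> h)"

text \<open>Homomorphisms are not required to be unital, so the usual condition that the module
  of an irreducible representation is not annihilated by the whole algebra is part of
  irreducibility. It rules out dimension \<open>0\<close> and the one-dimensional null representation.\<close>

definition irreducible_rep :: "'a::{finite, semigroup_mult} rep \<Rightarrow> bool" where
  "irreducible_rep \<rho> \<longleftrightarrow>
     representation \<rho> \<and>
     (\<exists>f. \<rho> f \<noteq> 0\<^sub>m (rep_dim \<rho>) (rep_dim \<rho>)) \<and>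
     (\<forall>W. VectorSpace.subspace class_ring W (module_vec TYPE(complex) (rep_dim \<rho>)) \<and>
          (\<forall>f. \<forall>w\<in>W. \<rho> f *\<^sub>v w \<in> W) \<longrightarrow>
          W = {0\<^sub>v (rep_dim \<rho>)} \<or> W = carrier_vec (rep_dim \<rho>))"

definition equivalent_rep :: "'a rep \<Rightarrow> 'a rep \<Rightarrow> bool" where
  "equivalent_rep \<rho> \<sigma> \<longleftrightarrow> (\<exists>P Q. \<forall>f. similar_mat_wit (\<rho> f) (\<sigma> f) P Q)"

definition complete_irreps :: "'a::{finite, semigroup_mult} rep set \<Rightarrow> bool" where
  "complete_irreps X \<longleftrightarrow>
     (\<forall>\<rho>\<in>X. irreducible_rep \<rho>) \<and>
     (\<forall>\<sigma>. irreducible_rep \<sigma> \<longrightarrow> (\<exists>!\<rho>. \<rho> \<in> X \<and> equivalent_rep \<sigma> \<rho>))"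

end

theory Submission
  imports Defs "Jordan_Normal_Form.DL_Rank" "Jordan_Normal_Form.Spectral_Radius"
begin

text \<open>
  Why the inversion formula holds. In the groupoid basis the algebra is a groupoid algebra:
  the product of two basis elements is the basis element of the product of their labels when
  the domain of the left label is the range of the right one, and \<open>0\<close> otherwise
  (\<open>groupoid_basis_mult\<close>). The coefficient of \<open>f\<close> at \<open>\<lfloor>t\<rfloor>\<close> is the sum of the values of \<open>f\<close>
  above \<open>t\<close>, called \<open>zeta f t\<close> below, because the sum of all \<open>\<lfloor>t\<rfloor>\<close> with \<open>t \<le> s\<close> is \<open>s\<close>.

  The trace of an element in the left regular representation can then be read off: it is the
  sum of its coefficients at \<open>ran y\<close> over all \<open>y\<close>. For \<open>g \<lfloor>s\<^sup>-\<^sup>1\<rfloor>\<close> only the \<open>y\<close> with the same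
  range as \<open>s\<close> contribute, each of them \<open>g(s)\<close>. There are \<open>r\<^sub>k |G\<^sub>k|\<close> such \<open>y\<close>
  (\<open>rclass_size_eq\<close>), since they are distributed by their domains over the \<open>r\<^sub>k\<close> idempotents of
  the \<open>\<D>\<close>-class of \<open>s\<close>, with \<open>|G\<^sub>k|\<close> of them for each. So the formula amounts to the classical
  statement that the regular character is the sum of all \<open>d\<^sub>\<rho> \<chi>\<^sub>\<rho>\<close> (\<open>regular_character\<close>).

  For the latter, passing to invariant subspaces and quotients shows that every character is a
  finite sum of irreducible ones (\<open>trace_decomposition\<close>), and the multiplicities in the regular
  character have to be determined. They are detected by the bilinear form
  \<open>\<langle>\<chi>, \<psi>\<rangle> = \<Sum>t. \<chi>(\<lfloor>t\<rfloor>) \<psi>(\<lfloor>t\<^sup>-\<^sup>1\<rfloor>) / N(t)\<close>, where \<open>N(t)\<close> is the number of elements with the range of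
  \<open>t\<close>. Averaging a matrix unit with these weights gives an intertwiner, so by Schur's lemma the
  irreducible characters are orthonormal for this form (\<open>character_orthogonality\<close>), whereas its
  value at the regular character and \<open>\<chi>\<^sub>\<sigma>\<close> is \<open>\<chi>\<^sub>\<sigma>(1) = d\<^sub>\<sigma>\<close> (\<open>regular_character_pairing\<close>).
  As \<open>d\<^sub>\<sigma> > 0\<close>, every irreducible representation occurs, which also shows that a complete set of
  irreducible representations is finite.
\<close>


section \<open>Inverse semigroups\<close>

lemma sg_inv_inv [simp]: "sg_inv (sg_inv x) = (x::'a::inverse_semigroup)"
  by (rule sg_inv_unique) (simp_all add: sg_inv)

lemma sg_inv_idem: "idem e \<Longrightarrow> sg_inv e = (e::'a::inverse_semigroup)"
  by (rule sg_inv_unique) (simp_all add: idem_def)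

lemma idem_dom [simp]: "idem (sg_dom (x::'a::inverse_semigroup))"
  and idem_ran [simp]: "idem (sg_ran x)"
  by (simp_all add: idem_def sg_dom_def sg_ran_def sg_inv mult.assoc[symmetric])

lemma idem_inv_mult [simp]: "idem (sg_inv (x::'a::inverse_semigroup) * x)"
  and idem_mult_inv [simp]: "idem (x * sg_inv x)"
  using idem_dom[of x] idem_ran[of x] by (simp_all only: sg_dom_def sg_ran_def)

lemma mult_dom [simp]: "x * sg_dom x = (x::'a::inverse_semigroup)"
  and ran_mult [simp]: "sg_ran x * x = x"
  by (simp_all add: sg_dom_def sg_ran_def sg_inv mult.assoc[symmetric])

lemma dom_inv [simp]: "sg_dom (sg_inv x) = sg_ran (x::'a::inverse_semigroup)"
  and ran_inv [simp]: "sg_ran (sg_inv x) = sg_dom x"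
  by (simp_all add: sg_dom_def sg_ran_def)

lemma dom_idem: "idem e \<Longrightarrow> sg_dom e = (e::'a::inverse_semigroup)"
  and ran_idem: "idem e \<Longrightarrow> sg_ran e = e"
  by (simp_all add: sg_dom_def sg_ran_def sg_inv_idem idem_def)

lemma sg_inv_mult: "sg_inv (x * y) = sg_inv y * sg_inv (x::'a::inverse_semigroup)"
proof (rule sg_inv_unique)
  have c: "y * sg_inv y * (sg_inv x * x) = sg_inv x * x * (y * sg_inv y)"
    by (rule idem_commute) simp_all
  have "x * y * (sg_inv y * sg_inv x) * (x * y) = x * (y * sg_inv y * (sg_inv x * x)) * y"
    by (simp add: mult.assoc)
  also have "\<dots> = (x * sg_inv x * x) * (y * sg_inv y * y)"
    unfolding c by (simp add: mult.assoc)
  finally show "x * y * (sg_inv y * sg_inv x) * (x * y) = x * y"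
    by (simp add: sg_inv)
  have "sg_inv y * sg_inv x * (x * y) * (sg_inv y * sg_inv x)
      = sg_inv y * (sg_inv x * x * (y * sg_inv y)) * sg_inv x"
    by (simp add: mult.assoc)
  also have "\<dots> = (sg_inv y * y * sg_inv y) * (sg_inv x * x * sg_inv x)"
    unfolding c[symmetric] by (simp add: mult.assoc)
  finally show "sg_inv y * sg_inv x * (x * y) * (sg_inv y * sg_inv x) = sg_inv y * sg_inv x"
    by (simp add: sg_inv)
qed

text \<open>The natural order is defined with idempotents on the left; conjugating by \<open>s\<close> moves an
  idempotent from the right of \<open>s\<close> to its left, so the order is symmetric in this respect.\<close>

lemma mult_idem_nat_le: "idem f \<Longrightarrow> nat_le (s * f) (s::'a::inverse_semigroup)"
  unfolding nat_le_def
proof (intro exI conjI)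
  assume f: "idem f"
  have c: "f * (sg_inv s * s) = sg_inv s * s * f"
    using f by (intro idem_commute) simp_all
  show "idem (s * f * sg_inv s)"
    unfolding idem_def using c f[unfolded idem_def] sg_inv[of s] by (metis mult.assoc)
  show "s * f = s * f * sg_inv s * s"
    using c sg_inv[of s] by (metis mult.assoc)
qed

lemma idem_mult_nat_le: "idem f \<Longrightarrow> nat_le (f * s) (s::'a::inverse_semigroup)"
  unfolding nat_le_def by blast

text \<open>An element below \<open>s\<close> is the restriction of \<open>s\<close> to its domain, hence it is determined by
  that domain.\<close>

lemma nat_le_eq_mult_dom:
  assumes "nat_le t (s::'a::inverse_semigroup)" shows "t = s * sg_dom t"
proof -
  obtain e where e: "idem e" "t = e * s" using assms nat_le_def by blast
  have c: "e * (s * sg_inv s) = s * sg_inv s * e"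
    using e by (intro idem_commute) simp_all
  have "sg_dom t = sg_inv s * e * s"
    using e unfolding sg_dom_def by (metis sg_inv_mult sg_inv_idem idem_def mult.assoc)
  then show ?thesis using c e sg_inv[of s] by (metis mult.assoc)
qed

lemma nat_le_mult:
  assumes "nat_le a s" "nat_le b (t::'a::inverse_semigroup)"
  shows "nat_le (a * b) (s * t)"
proof -
  obtain e where e: "idem e" "a = e * s" using assms nat_le_def by blast
  have "a * b = e * (s * t) * sg_dom b"
    using e nat_le_eq_mult_dom[OF assms(2)] by (metis mult.assoc)
  then show ?thesis
    using nat_le_partial_order(3) idem_mult_nat_le[OF e(1)] mult_idem_nat_le[OF idem_dom] by metis
qed

lemma
  assumes "sg_dom s = sg_ran (t::'a::inverse_semigroup)"
  shows dom_comp: "sg_dom (s * t) = sg_dom t" and ran_comp: "sg_ran (s * t) = sg_ran s"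
proof -
  have "sg_dom (s * t) = sg_inv t * sg_dom s * t"
    by (simp add: sg_dom_def sg_inv_mult mult.assoc)
  then show "sg_dom (s * t) = sg_dom t"
    by (simp only: assms mult.assoc ran_mult) (simp only: sg_dom_def)
  have "sg_ran (s * t) = s * sg_ran t * sg_inv s"
    by (simp add: sg_ran_def sg_inv_mult mult.assoc)
  then show "sg_ran (s * t) = sg_ran s"
    by (simp only: assms[symmetric] mult_dom) (simp only: sg_ran_def)
qed

text \<open>The heart of the passage to the groupoid: an element \<open>w\<close> below \<open>s t\<close> factors in exactly one
  way as a composable product \<open>(w v\<^sup>-\<^sup>1) v\<close> of an element below \<open>s\<close> and an element below \<open>t\<close>.
  The second factor has to be the restriction of \<open>t\<close> to the domain of \<open>w\<close>.\<close>

lemma product_below_iff: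
  fixes s t w :: "'a::inverse_semigroup"
  shows "sg_dom v = sg_dom w \<and> nat_le v t \<and> nat_le (w * sg_inv v) s \<longleftrightarrow>
    nat_le w (s * t) \<and> v = t * sg_dom w"
proof
  assume a: "sg_dom v = sg_dom w \<and> nat_le v t \<and> nat_le (w * sg_inv v) s"
  then have "nat_le (w * sg_inv v * v) (s * t)" by (intro nat_le_mult) auto
  moreover have "w * sg_inv v * v = w * sg_dom v" by (simp add: sg_dom_def mult.assoc)
  moreover have "v = t * sg_dom v" using a nat_le_eq_mult_dom by blast
  ultimately show "nat_le w (s * t) \<and> v = t * sg_dom w" using a by simp
next
  assume a: "nat_le w (s * t) \<and> v = t * sg_dom w"
  then have w: "s * t * sg_dom w = w" using nat_le_eq_mult_dom[of w "s * t"] by simp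
  have c: "sg_dom w * sg_dom t = sg_dom t * sg_dom w" by (intro idem_commute) simp_all
  have "w * sg_dom t = s * t * (sg_dom w * sg_dom t)" using w by (simp add: mult.assoc[symmetric])
  also have "\<dots> = s * (t * sg_dom t) * sg_dom w" unfolding c by (simp only: mult.assoc)
  finally have "w * sg_dom t = w" using w by simp
  then have "sg_dom w * sg_dom t = sg_dom w" by (simp add: sg_dom_def[of w] mult.assoc)
  then have dw: "sg_dom t * sg_dom w = sg_dom w" using c by simp
  have dv: "sg_dom v = sg_dom w"
  proof -
    have "sg_dom v = sg_dom w * (sg_dom t * sg_dom w)"
      using a unfolding sg_dom_def[of v]
      by (simp add: sg_inv_mult sg_inv_idem) (simp add: sg_dom_def[of t] mult.assoc)
    then show ?thesis using dw idem_dom[of w] by (simp add: idem_def)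
  qed
  moreover have "nat_le v t" using a mult_idem_nat_le[OF idem_dom] by auto
  moreover have "nat_le (w * sg_inv v) s"
  proof -
    have "w * sg_inv v = s * sg_ran v"
      using a w dv unfolding sg_ran_def
      by (metis mult.assoc)
    then show ?thesis by (simp add: mult_idem_nat_le)
  qed
  ultimately show "sg_dom v = sg_dom w \<and> nat_le v t \<and> nat_le (w * sg_inv v) s" by blast
qed


section \<open>The groupoid basis\<close>

text \<open>The coefficients of \<open>f\<close> with respect to the groupoid basis (see \<open>zeta_expansion\<close>).\<close>

definition zeta :: "('a::{finite, inverse_semigroup} \<Rightarrow> complex) \<Rightarrow> 'a \<Rightarrow> complex" where
  "zeta f u = (\<Sum>s | nat_le u s. f s)"

text \<open>Uniqueness in Moebius inversion, by induction along the order: the top term of the sum over a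
  down-set is the difference to the terms strictly below.\<close>

lemma downset_sums_determine:
  fixes F F' :: "'a::{finite, inverse_semigroup} \<Rightarrow> complex"
  assumes "\<And>s. (\<Sum>t | nat_le t s. F t) = (\<Sum>t | nat_le t s. F' t)"
  shows "F s = F' s"
proof -
  define R where "R = {(t, s :: 'a). nat_le t s \<and> t \<noteq> s}"
  have "trans R" "irrefl R"
    using nat_le_partial_order unfolding R_def trans_def irrefl_def by blast+
  then have wf: "wf R" by (simp add: finite_acyclic_wf acyclic_irrefl)
  show ?thesis
  proof (induction s rule: wf_induct_rule[OF wf])
    case (1 s)
    have "(\<Sum>t | nat_le t s. H t) = H s + (\<Sum>t | nat_le t s \<and> t \<noteq> s. H t)"
      for H :: "'a \<Rightarrow> complex"
    proof -
      have "{t. nat_le t s} = insert s {t. nat_le t s \<and> t \<noteq> s}"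
        using nat_le_partial_order(1) by blast
      then show ?thesis by simp
    qed
    moreover have "(\<Sum>t | nat_le t s \<and> t \<noteq> s. F t) = (\<Sum>t | nat_le t s \<and> t \<noteq> s. F' t)"
      using 1 by (intro sum.cong) (auto simp: R_def)
    ultimately show ?case using assms[of s] by simp
  qed
qed

lemma moebius_nat_le_sum:
  fixes x y :: "'a::{finite, inverse_semigroup}"
  assumes "nat_le x y"
  shows "(\<Sum>z | nat_le x z \<and> nat_le z y. moebius nat_le x z) = (if x = y then 1 else 0)"
proof -
  have "\<exists>!\<mu> :: 'a \<Rightarrow> 'a \<Rightarrow> int. \<forall>x y.
     (nat_le x y \<longrightarrow> (\<Sum>z | nat_le x z \<and> nat_le z y. \<mu> x z) = (if x = y then 1 else 0)) \<and>
     (\<not> nat_le x y \<longrightarrow> \<mu> x y = 0)"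
    by (rule moebius_ex1) (blast intro: nat_le_partial_order)+
  from theI'[OF this] assms show ?thesis unfolding moebius_def by blast
qed

lemma groupoid_basis_apply:
  "groupoid_basis s u = (if nat_le u s then of_int (moebius nat_le u s) else 0)"
proof -
  have "groupoid_basis s u = (\<Sum>t | nat_le t s. if u = t then of_int (moebius nat_le t s) else 0)"
    unfolding groupoid_basis_def by (intro sum.cong) auto
  then show ?thesis by simp
qed

text \<open>Moebius inversion: every semigroup element is the sum of the groupoid basis elements below it.\<close>

lemma sum_groupoid_basis_below:
  "(\<Sum>t | nat_le t s. groupoid_basis t u) = (if u = s then 1 else 0)"
proof -
  have "(\<Sum>t | nat_le t s. groupoid_basis t u) = (\<Sum>t | nat_le t s \<and> nat_le u t. of_int (moebius nat_le u t))"
    unfolding groupoid_basis_apply by (subst sum.inter_filter[symmetric]) (auto intro!: sum.cong)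
  also have "{t. nat_le t s \<and> nat_le u t} = {t. nat_le u t \<and> nat_le t s}" by auto
  also have "(\<Sum>t | nat_le u t \<and> nat_le t s. of_int (moebius nat_le u t)) = (if u = s then 1 else (0::complex))"
  proof (cases "nat_le u s")
    case True
    then show ?thesis
      using arg_cong[OF moebius_nat_le_sum[OF True], of "of_int :: int \<Rightarrow> complex"] by simp
  next
    case False
    then have "{t. nat_le u t \<and> nat_le t s} = {}" "u \<noteq> s"
      using nat_le_partial_order by blast+
    then show ?thesis by (simp only: sum.empty if_False)
  qed
  finally show ?thesis .
qed

lemma zeta_sum: "zeta (\<lambda>u. \<Sum>t\<in>T. c t * F t u) w = (\<Sum>t\<in>T. c t * zeta (F t) w)"
  unfolding zeta_def sum_distrib_left by (rule sum.swap)

lemma zeta_groupoid_basis: "zeta (groupoid_basis s) u = (if u = s then 1 else 0)"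
proof -
  have "(\<Sum>t | nat_le t s. zeta (groupoid_basis t) u) = (\<Sum>t | nat_le t s. if u = t then 1 else 0)" for s
  proof -
    have "(\<Sum>t | nat_le t s. zeta (groupoid_basis t) u)
        = zeta (\<lambda>v. \<Sum>t | nat_le t s. groupoid_basis t v) u"
      unfolding zeta_def by (rule sum.swap)
    also have "\<dots> = (if nat_le u s then 1 else 0)"
      unfolding sum_groupoid_basis_below zeta_def by simp
    finally show ?thesis by simp
  qed
  from downset_sums_determine[OF this] show ?thesis .
qed

lemma zeta_expansion: "f u = (\<Sum>t\<in>UNIV. zeta f t * groupoid_basis t u)"
proof -
  have "f u = (\<Sum>s\<in>UNIV. f s * (\<Sum>t | nat_le t s. groupoid_basis t u))"
    unfolding sum_groupoid_basis_below by (simp add: if_distrib[of "(*) _"] cong: if_cong)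
  also have "\<dots> = (\<Sum>s\<in>UNIV. \<Sum>t\<in>UNIV. if nat_le t s then f s * groupoid_basis t u else 0)"
    by (simp add: sum_distrib_left sum.If_cases)
  also have "\<dots> = (\<Sum>t\<in>UNIV. \<Sum>s\<in>UNIV. if nat_le t s then f s * groupoid_basis t u else 0)"
    by (rule sum.swap)
  also have "\<dots> = (\<Sum>t\<in>UNIV. zeta f t * groupoid_basis t u)"
    by (simp add: zeta_def sum_distrib_right sum.If_cases)
  finally show ?thesis .
qed

text \<open>The zeta transform turns the semigroup convolution into the groupoid convolution, because by
  \<open>product_below_iff\<close> each pair \<open>(s, t)\<close> with \<open>w \<le> s t\<close> is counted by exactly one \<open>v\<close>.\<close>

lemma zeta_sga_mult:
  "zeta (sga_mult f h) w = (\<Sum>v | sg_dom v = sg_dom w. zeta f (w * sg_inv v) * zeta h v)"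
proof -
  have "zeta (sga_mult f h) w = (\<Sum>p | nat_le w p. \<Sum>(s, t) | s * t = p. f s * h t)"
    by (simp add: zeta_def sga_mult_def)
  also have "\<dots> = (\<Sum>p\<in>{p. nat_le w p}. \<Sum>x\<in>{x \<in> {x. nat_le w (fst x * snd x)}. fst x * snd x = p}. f (fst x) * h (snd x))"
    by (intro sum.cong refl) (auto simp: case_prod_unfold)
  also have "\<dots> = (\<Sum>x | nat_le w (fst x * snd x). f (fst x) * h (snd x))"
    by (rule sum.group) auto
  also have "\<dots> = (\<Sum>x\<in>UNIV. if nat_le w (fst x * snd x) then f (fst x) * h (snd x) else 0)"
    by (simp add: sum.If_cases)
  also have "\<dots> = (\<Sum>x\<in>UNIV. \<Sum>v | sg_dom v = sg_dom w.
      if nat_le (w * sg_inv v) (fst x) \<and> nat_le v (snd x) then f (fst x) * h (snd x) else 0)"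
  proof (intro sum.cong refl)
    fix x :: "'a \<times> 'a"
    let ?c = "f (fst x) * h (snd x)"
    have "(\<Sum>v | sg_dom v = sg_dom w. if nat_le (w * sg_inv v) (fst x) \<and> nat_le v (snd x) then ?c else 0)
      = (\<Sum>v\<in>{v. sg_dom v = sg_dom w \<and> nat_le v (snd x) \<and> nat_le (w * sg_inv v) (fst x)}. ?c)"
      by (subst sum.inter_filter[symmetric], simp) (intro sum.cong, auto)
    also have "\<dots> = (if nat_le w (fst x * snd x) then ?c else 0)"
      unfolding product_below_iff by simp
    finally show "(if nat_le w (fst x * snd x) then ?c else 0) = (\<Sum>v | sg_dom v = sg_dom w.
      if nat_le (w * sg_inv v) (fst x) \<and> nat_le v (snd x) then ?c else 0)" by simp
  qed
  also have "\<dots> = (\<Sum>v | sg_dom v = sg_dom w. \<Sum>x\<in>UNIV.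
      if nat_le (w * sg_inv v) (fst x) \<and> nat_le v (snd x) then f (fst x) * h (snd x) else 0)"
    by (rule sum.swap)
  also have "\<dots> = (\<Sum>v | sg_dom v = sg_dom w. zeta f (w * sg_inv v) * zeta h v)"
  proof (intro sum.cong refl)
    fix v
    have "(\<Sum>x\<in>UNIV. if nat_le (w * sg_inv v) (fst x) \<and> nat_le v (snd x) then f (fst x) * h (snd x) else 0)
      = (\<Sum>x\<in>{s. nat_le (w * sg_inv v) s} \<times> {t. nat_le v t}. f (fst x) * h (snd x))"
      by (subst sum.inter_filter[symmetric], simp) (intro sum.cong, auto)
    then show "(\<Sum>x\<in>UNIV. if nat_le (w * sg_inv v) (fst x) \<and> nat_le v (snd x) then f (fst x) * h (snd x) else 0)
      = zeta f (w * sg_inv v) * zeta h v"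
      by (simp add: zeta_def sum_product sum.cartesian_product case_prod_unfold)
  qed
  finally show ?thesis .
qed

lemma groupoid_basis_mult:
  "sga_mult (groupoid_basis s) (groupoid_basis t) =
    (if sg_dom s = sg_ran t then groupoid_basis (s * t) else (\<lambda>_. 0))"
proof
  fix u
  have z: "zeta (sga_mult (groupoid_basis s) (groupoid_basis t)) w
    = (if sg_dom s = sg_ran t \<and> w = s * t then 1 else 0)" for w
  proof -
    have "zeta (sga_mult (groupoid_basis s) (groupoid_basis t)) w
      = (\<Sum>v | sg_dom v = sg_dom w. if v = t then (if w * sg_inv t = s then 1 else 0) else 0)"
      unfolding zeta_sga_mult zeta_groupoid_basis by (intro sum.cong) auto
    also have "\<dots> = (if sg_dom t = sg_dom w \<and> w * sg_inv t = s then 1 else 0)"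
      by simp
    also have "sg_dom t = sg_dom w \<and> w * sg_inv t = s \<longleftrightarrow> sg_dom s = sg_ran t \<and> w = s * t"
    proof safe
      assume a: "sg_dom t = sg_dom w"
      then show "sg_dom (w * sg_inv t) = sg_ran t"
        using dom_comp[of w "sg_inv t"] by simp
      show "w = w * sg_inv t * t"
        using a mult_dom[of w] by (simp add: sg_dom_def mult.assoc)
    next
      assume a: "sg_dom s = sg_ran t"
      then show "sg_dom t = sg_dom (s * t)" by (simp add: dom_comp)
      show "s * t * sg_inv t = s"
        using a mult_dom[of s] by (simp add: sg_ran_def mult.assoc)
    qed
    finally show ?thesis .
  qed
  show "sga_mult (groupoid_basis s) (groupoid_basis t) u =
    (if sg_dom s = sg_ran t then groupoid_basis (s * t) else (\<lambda>_. 0)) u"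
    by (subst zeta_expansion) (auto simp: z if_distrib[of "\<lambda>x. x * _"] cong: if_cong)
qed


section \<open>Subspaces, adapted bases and traces\<close>

abbreviation is_subspace :: "nat \<Rightarrow> complex vec set \<Rightarrow> bool" where
  "is_subspace n W \<equiv> VectorSpace.subspace class_ring W (module_vec TYPE(complex) n)"

lemma is_subspace_iff:
  "is_subspace n W \<longleftrightarrow> W \<subseteq> carrier_vec n \<and> 0\<^sub>v n \<in> W \<and> (\<forall>v\<in>W. \<forall>w\<in>W. v + w \<in> W) \<and> (\<forall>c. \<forall>v\<in>W. c \<cdot>\<^sub>v v \<in> W)"
  (is "?l = ?r")
proof
  assume ?l
  then interpret submodule class_ring W "module_vec TYPE(complex) n"
    by (simp add: VectorSpace.subspace_def)
  show ?r
    using subset m_closed zero_closed smult_closed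
    by (auto simp: module_vec_simps class_ring_simps)
next
  assume ?r
  then show ?l
    unfolding VectorSpace.subspace_def submodule_def
    using vec_vs[where ?'a = complex] vec_module[where ?'a = complex]
    by (simp add: module_vec_simps class_ring_simps subset_iff)
qed

text \<open>In the basis of the columns of \<open>P\<close>, the subspace \<open>W\<close> is spanned by the first \<open>m\<close> basis vectors:
  a maximal independent subset \<open>B\<close> of \<open>W\<close> is extended to a maximal independent set \<open>C\<close>. The matrix
  \<open>Q\<close> computes coordinates in the new basis, so its rows from \<open>m\<close> on vanish on \<open>W\<close>.\<close>

lemma adapted_basis:
  assumes W: "is_subspace n W"
  obtains m P Q where "m \<le> n" "W \<noteq> {0\<^sub>v n} \<Longrightarrow> 0 < m" "W \<noteq> carrier_vec n \<Longrightarrow> m < n"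
    "P \<in> carrier_mat n n" "Q \<in> carrier_mat n n"
    "P * Q = 1\<^sub>m n" "Q * P = 1\<^sub>m n"
    "\<And>j. j < m \<Longrightarrow> col P j \<in> W"
    "\<And>w i. w \<in> W \<Longrightarrow> m \<le> i \<Longrightarrow> i < n \<Longrightarrow> (Q *\<^sub>v w) $ i = 0"
proof -
  interpret vec_space "TYPE(complex)" n .
  have Wc: "W \<subseteq> carrier_vec n" using W by (simp add: is_subspace_iff)
  have bounded: "finite S \<and> card S \<le> dim" if "S \<subseteq> carrier_vec n" "lin_indpt S" for S
    using li_le_dim[OF fin_dim] that by simp
  have li0: "lin_indpt {}" by (simp add: lin_dep_def)
  obtain B where B: "finite B" "maximal B (\<lambda>S. S \<subseteq> W \<and> lin_indpt S)"
  proof -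
    have "\<exists>B. finite B \<and> maximal B (\<lambda>S. S \<subseteq> W \<and> lin_indpt S)"
    proof (rule maximal_exists)
      show "finite S \<and> card S \<le> dim" if "S \<subseteq> W \<and> lin_indpt S" for S
        using that bounded Wc by (meson order_trans)
      show "{} \<subseteq> W \<and> lin_indpt {}" using li0 by simp
    qed
    then show thesis using that by blast
  qed
  then have BW: "B \<subseteq> W" and liB: "lin_indpt B" by (auto simp: maximal_def)
  have WB: "W \<subseteq> span B"
  proof
    fix w assume w: "w \<in> W"
    show "w \<in> span B"
    proof (cases "w \<in> B")
      case True then show ?thesis using span_mem BW Wc by auto
    next
      case False
      then have "lin_dep (B \<union> {w})"
        using B(2) BW w unfolding maximal_def by auto
      then show ?thesis using lin_dep_iff_in_span[of B w] False BW Wc w liB by auto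
    qed
  qed
  obtain C where C: "finite C" "maximal C (\<lambda>S. S \<subseteq> carrier_vec n \<and> B \<subseteq> S \<and> lin_indpt S)"
  proof -
    have "\<exists>C. finite C \<and> maximal C (\<lambda>S. S \<subseteq> carrier_vec n \<and> B \<subseteq> S \<and> lin_indpt S)"
    proof (rule maximal_exists)
      show "finite S \<and> card S \<le> dim" if "S \<subseteq> carrier_vec n \<and> B \<subseteq> S \<and> lin_indpt S" for S
        using that bounded by blast
      show "B \<subseteq> carrier_vec n \<and> B \<subseteq> B \<and> lin_indpt B" using liB BW Wc by auto
    qed
    then show thesis using that by blast
  qed
  then have CC: "C \<subseteq> carrier_vec n" "B \<subseteq> C" "lin_indpt C" by (auto simp: maximal_def)
  have "maximal C (\<lambda>S. S \<subseteq> carrier_vec n \<and> lin_indpt S)"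
    using C(2) unfolding maximal_def by (meson CC(2) order_trans)
  then have "basis C" using max_li_is_basis by simp
  then have cC: "card C = n" using dim_basis[OF C(1)] dim_is_n by simp
  obtain xs where xs: "set xs = B" "distinct xs" using finite_distinct_list[OF B(1)] by metis
  obtain ys where ys: "set ys = C - B" "distinct ys" using finite_distinct_list[OF finite_Diff[OF C(1)]] by metis
  define P where "P = mat_of_cols n (xs @ ys)"
  have len: "length xs + length ys = n"
  proof -
    have "card (C - B) + card B = card C"
      using card_Diff_subset[OF B(1) CC(2)] card_mono[OF C(1) CC(2)] by simp
    then show ?thesis
      using cC xs ys distinct_card[of xs] distinct_card[of ys] by simp
  qed
  have P: "P \<in> carrier_mat n n" unfolding P_def using len by auto
  have cols: "cols P = xs @ ys"
    unfolding P_def using xs ys CC by (intro cols_mat_of_cols) auto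
  have "rank P = n"
    using lin_indpt_full_rank[OF P] cols xs ys CC by (auto simp: Un_absorb1)
  then have "det P \<noteq> 0" using det_rank_iff[OF P] by simp
  then obtain Q where Q: "Q \<in> carrier_mat n n" "P * Q = 1\<^sub>m n" "Q * P = 1\<^sub>m n"
    using det_non_zero_imp_unit[OF P, of "TYPE(complex)"] unfolding Units_def ring_mat_def by auto
  show thesis
  proof (rule that[of "length xs" P Q])
    show "length xs \<le> n" using len by simp
    show "0 < length xs" if "W \<noteq> {0\<^sub>v n}"
    proof (rule ccontr)
      assume "\<not> 0 < length xs"
      then have "W \<subseteq> {0\<^sub>v n}" using WB xs(1) span_empty by simp
      then show False using that W by (auto simp: is_subspace_iff)
    qed
    show "length xs < n" if "W \<noteq> carrier_vec n"
    proof (rule ccontr)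
      assume "\<not> length xs < n"
      then have "B = C" using len xs ys CC(2) by auto
      then have "carrier_vec n = span B" using \<open>basis C\<close> by (simp add: basis_def)
      also have "\<dots> \<subseteq> W"
        using W BW by (intro span_is_subset) (auto simp: VectorSpace.subspace_def)
      finally show False using that Wc by blast
    qed
    show "P \<in> carrier_mat n n" "Q \<in> carrier_mat n n" "P * Q = 1\<^sub>m n" "Q * P = 1\<^sub>m n" using P Q by auto
    fix j assume "j < length xs"
    then show "col P j \<in> W"
      using len xs BW cols P by (metis cols_nth carrier_matD(2) nth_append nth_mem subsetD trans_less_add1)
  next
    fix w i assume w: "w \<in> W" and i: "length xs \<le> i" "i < n"
    have "w \<in> span_list xs"
      using w WB xs span_list_as_span[of xs] BW Wc by auto
    then obtain c where c: "w = lincomb_list c xs" unfolding span_list_def by auto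
    have "w = mat_of_cols n xs *\<^sub>v vec (length xs) c"
      unfolding c using xs BW Wc by (intro lincomb_list_as_mat_mult) (auto simp: subset_iff)
    also have "\<dots> = P *\<^sub>v vec n (\<lambda>j. if j < length xs then c j else 0)" (is "_ = P *\<^sub>v ?v")
    proof (rule eq_vecI)
      fix k assume "k < dim_vec (P *\<^sub>v ?v)"
      then have k: "k < n" using P by simp
      have "(P *\<^sub>v ?v) $ k = (\<Sum>j = 0..<n. P $$ (k, j) * (if j < length xs then c j else 0))"
        using k P by (simp add: scalar_prod_def)
      also have "\<dots> = (\<Sum>j = 0..<length xs. P $$ (k, j) * c j)"
        using len by (intro sum.mono_neutral_cong_right) auto
      also have "\<dots> = (mat_of_cols n xs *\<^sub>v vec (length xs) c) $ k"
        using k len by (simp add: scalar_prod_def P_def mat_of_cols_index nth_append)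
      finally show "(mat_of_cols n xs *\<^sub>v vec (length xs) c) $ k = (P *\<^sub>v ?v) $ k" by simp
    qed (use P in auto)
    finally have "Q *\<^sub>v w = (Q * P) *\<^sub>v ?v"
      using assoc_mult_mat_vec[OF Q(1) P, of ?v] by simp
    then show "(Q *\<^sub>v w) $ i = 0" using Q i by simp
  qed
qed

lemma mat_trace_comm:
  assumes "A \<in> carrier_mat n m" "B \<in> carrier_mat m n"
  shows "mat_trace (A * B) = mat_trace (B * A)"
proof -
  have "mat_trace (A * B) = (\<Sum>i<n. \<Sum>j<m. A $$ (i, j) * B $$ (j, i))"
    using assms by (simp add: mat_trace_def scalar_prod_def atLeast0LessThan)
  also have "\<dots> = (\<Sum>j<m. \<Sum>i<n. B $$ (j, i) * A $$ (i, j))"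
    by (subst sum.swap) (simp add: mult.commute)
  also have "\<dots> = mat_trace (B * A)"
    using assms by (simp add: mat_trace_def scalar_prod_def atLeast0LessThan)
  finally show ?thesis .
qed


section \<open>Matrix representations\<close>

lemma mat_eq_by_vec:
  fixes A B :: "complex mat"
  assumes A: "A \<in> carrier_mat n m" and B: "B \<in> carrier_mat n m"
    and eq: "\<And>v. v \<in> carrier_vec m \<Longrightarrow> A *\<^sub>v v = B *\<^sub>v v"
  shows "A = B"
proof (rule eq_matI)
  fix i j assume ij: "i < dim_row B" "j < dim_col B"
  have "(M *\<^sub>v unit_vec m j) $ i = M $$ (i, j)" if "M \<in> carrier_mat n m" for M :: "complex mat"
    using that ij B by (simp add: scalar_prod_def if_distrib[of "(*) _"] cong: if_cong)
  then show "A $$ (i, j) = B $$ (i, j)" using A B eq[of "unit_vec m j"] by (metis unit_vec_carrier)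
qed (use A B in auto)

lemma representationD:
  assumes "representation \<rho>"
  shows "\<rho> f \<in> carrier_mat (rep_dim \<rho>) (rep_dim \<rho>)"
    and "\<rho> (sga_add f h) = \<rho> f + \<rho> h"
    and "\<rho> (sga_scale c f) = c \<cdot>\<^sub>m \<rho> f"
    and "\<rho> (sga_mult f h) = \<rho> f * \<rho> h"
  using assms unfolding representation_def by blast+

lemma irreducible_repD: "irreducible_rep \<rho> \<Longrightarrow> representation \<rho>"
  by (simp add: irreducible_rep_def)

lemma rep_zero:
  assumes "representation \<rho>"
  shows "\<rho> (\<lambda>_. 0) = 0\<^sub>m (rep_dim \<rho>) (rep_dim \<rho>)"
proof -
  have "\<rho> (sga_scale 0 (\<lambda>_. 0)) = 0 \<cdot>\<^sub>m \<rho> (\<lambda>_. 0)" using assms by (rule representationD)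
  moreover have "0 \<cdot>\<^sub>m A = 0\<^sub>m n n" if "A \<in> carrier_mat n n" for A :: "complex mat" and n
    using that by (intro eq_matI) auto
  ultimately show ?thesis
    using representationD(1)[OF assms, of "\<lambda>_. 0"] by (simp add: sga_scale_def)
qed

lemma rep_sum:
  assumes \<rho>: "representation \<rho>" and "finite T" "i < rep_dim \<rho>" "j < rep_dim \<rho>"
  shows "\<rho> (\<lambda>u. \<Sum>t\<in>T. c t * F t u) $$ (i, j) = (\<Sum>t\<in>T. c t * \<rho> (F t) $$ (i, j))"
  using assms(2)
proof (induction T)
  case empty
  then show ?case using assms(3,4) rep_zero[OF \<rho>] by simp
next
  case (insert t T)
  have "\<rho> (\<lambda>u. \<Sum>t\<in>insert t T. c t * F t u) = \<rho> (sga_add (sga_scale (c t) (F t)) (\<lambda>u. \<Sum>t\<in>T. c t * F t u))"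
    using insert by (simp add: sga_add_def sga_scale_def)
  also have "\<dots> = c t \<cdot>\<^sub>m \<rho> (F t) + \<rho> (\<lambda>u. \<Sum>t\<in>T. c t * F t u)"
    using representationD[OF \<rho>] by simp
  finally show ?case
    using insert assms(3,4) representationD(1)[OF \<rho>, of "F t"]
      representationD(1)[OF \<rho>, of "\<lambda>u. \<Sum>t\<in>T. c t * F t u"] by simp
qed

lemma rep_trace_sum:
  assumes \<rho>: "representation \<rho>" and "finite T"
  shows "mat_trace (\<rho> (\<lambda>u. \<Sum>t\<in>T. c t * F t u)) = (\<Sum>t\<in>T. c t * mat_trace (\<rho> (F t)))"
proof -
  have d: "dim_row (\<rho> f) = rep_dim \<rho>" for f using representationD(1)[OF \<rho>, of f] by simp
  have "mat_trace (\<rho> (\<lambda>u. \<Sum>t\<in>T. c t * F t u)) = (\<Sum>i<rep_dim \<rho>. \<Sum>t\<in>T. c t * \<rho> (F t) $$ (i, i))"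
    unfolding mat_trace_def d by (intro sum.cong) (simp_all add: rep_sum[OF \<rho> assms(2)])
  also have "\<dots> = (\<Sum>t\<in>T. c t * mat_trace (\<rho> (F t)))"
    unfolding mat_trace_def d sum_distrib_left by (rule sum.swap)
  finally show ?thesis .
qed

text \<open>A diagonal block of a representation is again a representation as soon as no product
  passes from the block out of it and back. This covers both blocks of a block triangular form.\<close>

lemma block_representation:
  fixes M :: "'a::{finite, semigroup_mult} rep"
  assumes M: "representation M" and ab: "a \<le> b" "b \<le> rep_dim M"
    and z: "\<And>f h i j k. a \<le> i \<Longrightarrow> i < b \<Longrightarrow> a \<le> j \<Longrightarrow> j < b \<Longrightarrow> k < rep_dim M \<Longrightarrow> k \<notin> {a..<b} \<Longrightarrow>
      M f $$ (i, k) * M h $$ (k, j) = 0"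
  defines "\<tau> \<equiv> \<lambda>f. mat (b - a) (b - a) (\<lambda>(i, j). M f $$ (i + a, j + a))"
  shows "representation \<tau>" "rep_dim \<tau> = b - a" "mat_trace (\<tau> f) = (\<Sum>i\<in>{a..<b}. M f $$ (i, i))"
proof -
  show dim: "rep_dim \<tau> = b - a" by (simp add: rep_dim_def \<tau>_def)
  have mult: "\<tau> (sga_mult f h) = \<tau> f * \<tau> h" for f h
  proof (rule eq_matI)
    fix i j assume "i < dim_row (\<tau> f * \<tau> h)" "j < dim_col (\<tau> f * \<tau> h)"
    then have ij: "i < b - a" "j < b - a" by (simp_all add: \<tau>_def)
    then have ij': "i + a < b" "j + a < b" by simp_all
    have "\<tau> (sga_mult f h) $$ (i, j) = (\<Sum>k = 0..<rep_dim M. M f $$ (i + a, k) * M h $$ (k, j + a))"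
      using ij ij' ab representationD(1)[OF M, of f] representationD(1)[OF M, of h]
      by (simp add: \<tau>_def representationD(4)[OF M] scalar_prod_def)
    also have "\<dots> = (\<Sum>k = a..<b. M f $$ (i + a, k) * M h $$ (k, j + a))"
      using ij' ab z[of "i + a" "j + a"] by (intro sum.mono_neutral_right) auto
    also have "\<dots> = (\<Sum>k = 0..<b - a. M f $$ (i + a, k + a) * M h $$ (k + a, j + a))"
      using ab sum.shift_bounds_nat_ivl[of _ 0 a "b - a"] by simp
    also have "\<dots> = (\<tau> f * \<tau> h) $$ (i, j)"
      using ij by (simp add: \<tau>_def scalar_prod_def)
    finally show "\<tau> (sga_mult f h) $$ (i, j) = (\<tau> f * \<tau> h) $$ (i, j)" .
  qed (simp_all add: \<tau>_def)
  have add: "\<tau> (sga_add f h) = \<tau> f + \<tau> h" for f h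
  proof (rule eq_matI)
    fix i j assume "i < dim_row (\<tau> f + \<tau> h)" "j < dim_col (\<tau> f + \<tau> h)"
    then have ij: "i < b - a" "j < b - a" by (simp_all add: \<tau>_def)
    then show "\<tau> (sga_add f h) $$ (i, j) = (\<tau> f + \<tau> h) $$ (i, j)"
      using ab representationD(1)[OF M, of f] representationD(1)[OF M, of h]
      by (simp add: \<tau>_def representationD(2)[OF M])
  qed (simp_all add: \<tau>_def)
  have scale: "\<tau> (sga_scale c f) = c \<cdot>\<^sub>m \<tau> f" for c f
  proof (rule eq_matI)
    fix i j assume "i < dim_row (c \<cdot>\<^sub>m \<tau> f)" "j < dim_col (c \<cdot>\<^sub>m \<tau> f)"
    then have ij: "i < b - a" "j < b - a" by (simp_all add: \<tau>_def)
    then show "\<tau> (sga_scale c f) $$ (i, j) = (c \<cdot>\<^sub>m \<tau> f) $$ (i, j)"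
      using ab representationD(1)[OF M, of f]
      by (simp add: \<tau>_def representationD(3)[OF M])
  qed (simp_all add: \<tau>_def)
  show "representation \<tau>"
    unfolding representation_def dim using mult add scale by (simp add: \<tau>_def)
  show "mat_trace (\<tau> f) = (\<Sum>i\<in>{a..<b}. M f $$ (i, i))"
    using ab sum.shift_bounds_nat_ivl[of "\<lambda>i. M f $$ (i, i)" 0 a "b - a"]
    by (simp add: mat_trace_def \<tau>_def atLeast0LessThan)
qed

lemma conjugate_representation:
  fixes \<rho> :: "'a::{finite, semigroup_mult} rep"
  assumes \<rho>: "representation \<rho>" and n: "n = rep_dim \<rho>"
    and P: "P \<in> carrier_mat n n" and Q: "Q \<in> carrier_mat n n" and PQ: "P * Q = 1\<^sub>m n"
  defines "M \<equiv> \<lambda>f. Q * (\<rho> f * P)"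
  shows "representation M" "rep_dim M = n" "mat_trace (M f) = mat_trace (\<rho> f)"
proof -
  note r = representationD[OF \<rho>, folded n]
  have M: "M f \<in> carrier_mat n n" for f
    unfolding M_def using r(1)[of f] P Q by auto
  show dim: "rep_dim M = n" unfolding rep_dim_def using M by auto
  have "M (sga_mult f h) = M f * M h" for f h
  proof -
    have "M f * M h = Q * (\<rho> f * ((P * Q) * (\<rho> h * P)))"
      unfolding M_def using r(1)[of f] r(1)[of h] P Q
      by (simp add: assoc_mult_mat[of _ n n _ n _ n])
    also have "\<dots> = M (sga_mult f h)"
      unfolding M_def r(4) PQ using r(1)[of f] r(1)[of h] P Q
      by (simp add: assoc_mult_mat[of _ n n _ n _ n])
    finally show ?thesis ..
  qed
  moreover have "M (sga_add f h) = M f + M h" for f h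
    unfolding M_def r(2) using r(1)[of f] r(1)[of h] P Q
    by (simp add: add_mult_distrib_mat[of _ n n _ _ n] mult_add_distrib_mat[of _ n n _ n])
  moreover have "M (sga_scale c f) = c \<cdot>\<^sub>m M f" for c f
    unfolding M_def r(3) using r(1)[of f] P Q
    by (simp add: mult_smult_assoc_mat[of _ n n _ n] mult_smult_distrib[of _ n n _ n])
  ultimately show "representation M" unfolding representation_def dim using M by blast
  have "mat_trace (M f) = mat_trace ((\<rho> f * P) * Q)"
    unfolding M_def using r(1)[of f] P Q by (intro mat_trace_comm[of _ n n]) auto
  also have "(\<rho> f * P) * Q = \<rho> f"
    using r(1)[of f] P Q PQ by (simp add: assoc_mult_mat[of _ n n _ n _ n])
  finally show "mat_trace (M f) = mat_trace (\<rho> f)" .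
qed

text \<open>In a basis adapted to an invariant subspace the matrices are block triangular. The two diagonal
  blocks (the actions on the subspace and on the quotient) have smaller dimension and share the
  trace.\<close>

lemma trace_split:
  fixes \<rho> :: "'a::{finite, semigroup_mult} rep"
  assumes \<rho>: "representation \<rho>" and W: "is_subspace (rep_dim \<rho>) W"
    and inv: "\<And>f w. w \<in> W \<Longrightarrow> \<rho> f *\<^sub>v w \<in> W"
    and ne: "W \<noteq> {0\<^sub>v (rep_dim \<rho>)}" "W \<noteq> carrier_vec (rep_dim \<rho>)"
  obtains \<rho>\<^sub>1 \<rho>\<^sub>2 where "representation \<rho>\<^sub>1" "representation \<rho>\<^sub>2"
    "rep_dim \<rho>\<^sub>1 < rep_dim \<rho>" "rep_dim \<rho>\<^sub>2 < rep_dim \<rho>"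
    "\<And>f. mat_trace (\<rho> f) = mat_trace (\<rho>\<^sub>1 f) + mat_trace (\<rho>\<^sub>2 f)"
proof -
  define n where "n = rep_dim \<rho>"
  note r = representationD[OF \<rho>, folded n_def]
  obtain m P Q where m: "0 < m" "m < n" and P: "P \<in> carrier_mat n n" and Q: "Q \<in> carrier_mat n n"
    and PQ: "P * Q = 1\<^sub>m n" and Pc: "\<And>j. j < m \<Longrightarrow> col P j \<in> W"
    and Qz: "\<And>w i. w \<in> W \<Longrightarrow> m \<le> i \<Longrightarrow> i < n \<Longrightarrow> (Q *\<^sub>v w) $ i = 0"
    using adapted_basis[OF W] ne unfolding n_def by metis
  define M where "M = (\<lambda>f. Q * (\<rho> f * P))"
  have M: "representation M" "rep_dim M = n" "mat_trace (M f) = mat_trace (\<rho> f)" for f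
    unfolding M_def by (rule conjugate_representation[OF \<rho> n_def P Q PQ])+
  have zero: "M f $$ (i, j) = 0" if "m \<le> i" "i < n" "j < m" for f i j
  proof -
    have "M f $$ (i, j) = row Q i \<bullet> col (\<rho> f * P) j"
      unfolding M_def using that m r(1)[of f] P Q by simp
    also have "col (\<rho> f * P) j = \<rho> f *\<^sub>v col P j"
      using that m r(1)[of f] P by (intro col_mult2[of _ n n _ n]) auto
    also have "row Q i \<bullet> (\<rho> f *\<^sub>v col P j) = (Q *\<^sub>v (\<rho> f *\<^sub>v col P j)) $ i"
      using that Q by simp
    also have "\<dots> = 0" using that inv Pc by (intro Qz) auto
    finally show ?thesis .
  qed
  define \<rho>\<^sub>1 where "\<rho>\<^sub>1 = (\<lambda>f. mat (m - 0) (m - 0) (\<lambda>(i, j). M f $$ (i + 0, j + 0)))"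
  define \<rho>\<^sub>2 where "\<rho>\<^sub>2 = (\<lambda>f. mat (n - m) (n - m) (\<lambda>(i, j). M f $$ (i + m, j + m)))"
  have 1: "representation \<rho>\<^sub>1" "rep_dim \<rho>\<^sub>1 = m - 0" "mat_trace (\<rho>\<^sub>1 f) = (\<Sum>i\<in>{0..<m}. M f $$ (i, i))" for f
    unfolding \<rho>\<^sub>1_def by (rule block_representation[OF M(1)]; use m M(2) zero in auto)+
  have 2: "representation \<rho>\<^sub>2" "rep_dim \<rho>\<^sub>2 = n - m" "mat_trace (\<rho>\<^sub>2 f) = (\<Sum>i\<in>{m..<n}. M f $$ (i, i))" for f
    unfolding \<rho>\<^sub>2_def by (rule block_representation[OF M(1)]; use m M(2) zero in auto)+
  show thesis
  proof (rule that[OF 1(1) 2(1)])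
    show "rep_dim \<rho>\<^sub>1 < rep_dim \<rho>" "rep_dim \<rho>\<^sub>2 < rep_dim \<rho>"
      unfolding 1 2 n_def[symmetric] using m by auto
    fix f
    have "mat_trace (\<rho> f) = mat_trace (M f)" by (rule M(3)[symmetric])
    also have "\<dots> = (\<Sum>i\<in>{0..<n}. M f $$ (i, i))"
      using representationD(1)[OF M(1), of f] unfolding mat_trace_def M(2)
      by (simp add: atLeast0LessThan)
    also have "\<dots> = mat_trace (\<rho>\<^sub>1 f) + mat_trace (\<rho>\<^sub>2 f)"
      unfolding 1 2 using m by (simp add: sum.atLeastLessThan_concat)
    finally show "mat_trace (\<rho> f) = mat_trace (\<rho>\<^sub>1 f) + mat_trace (\<rho>\<^sub>2 f)" .
  qed
qed

text \<open>The composition factors of a representation carry its character. Null factors, which are not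
  irreducible here, have trace \<open>0\<close> and are dropped.\<close>

lemma trace_decomposition:
  fixes \<rho> :: "'a::{finite, semigroup_mult} rep"
  assumes "representation \<rho>"
  shows "\<exists>\<sigma>s. (\<forall>\<sigma>\<in>set \<sigma>s. irreducible_rep \<sigma>) \<and> (\<forall>f. mat_trace (\<rho> f) = (\<Sum>\<sigma>\<leftarrow>\<sigma>s. mat_trace (\<sigma> f)))"
  using assms
proof (induction "rep_dim \<rho>" arbitrary: \<rho> rule: less_induct)
  case less
  \<comment> \<open>A representation that is not irreducible is null or has a proper invariant subspace.\<close>
  consider "irreducible_rep \<rho>" | "\<forall>f. \<rho> f = 0\<^sub>m (rep_dim \<rho>) (rep_dim \<rho>)"
    | W where "is_subspace (rep_dim \<rho>) W" "\<forall>f. \<forall>w\<in>W. \<rho> f *\<^sub>v w \<in> W"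
      "W \<noteq> {0\<^sub>v (rep_dim \<rho>)}" "W \<noteq> carrier_vec (rep_dim \<rho>)"
    using less.prems unfolding irreducible_rep_def by blast
  then show ?case
  proof cases
    case 1
    then show ?thesis by (intro exI[of _ "[\<rho>]"]) simp
  next
    case 2
    then have "mat_trace (\<rho> f) = 0" for f by (simp add: mat_trace_def)
    then show ?thesis by (intro exI[of _ "[]"]) simp
  next
    case (3 W)
    obtain \<rho>\<^sub>1 \<rho>\<^sub>2 where a: "representation \<rho>\<^sub>1" "representation \<rho>\<^sub>2"
      "rep_dim \<rho>\<^sub>1 < rep_dim \<rho>" "rep_dim \<rho>\<^sub>2 < rep_dim \<rho>"
      "\<And>f. mat_trace (\<rho> f) = mat_trace (\<rho>\<^sub>1 f) + mat_trace (\<rho>\<^sub>2 f)"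
      using trace_split[OF less.prems 3(1) _ 3(3,4)] 3(2) by blast
    obtain as where "\<forall>\<sigma>\<in>set as. irreducible_rep \<sigma>" "\<forall>f. mat_trace (\<rho>\<^sub>1 f) = (\<Sum>\<sigma>\<leftarrow>as. mat_trace (\<sigma> f))"
      using less.hyps[OF a(3,1)] by blast
    moreover obtain bs where "\<forall>\<sigma>\<in>set bs. irreducible_rep \<sigma>" "\<forall>f. mat_trace (\<rho>\<^sub>2 f) = (\<Sum>\<sigma>\<leftarrow>bs. mat_trace (\<sigma> f))"
      using less.hyps[OF a(4,2)] by blast
    ultimately show ?thesis using a(5) by (intro exI[of _ "as @ bs"]) auto
  qed
qed

lemma irreducible_subspace:
  assumes "irreducible_rep \<rho>" "is_subspace (rep_dim \<rho>) W" "\<And>f w. w \<in> W \<Longrightarrow> \<rho> f *\<^sub>v w \<in> W"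
  shows "W = {0\<^sub>v (rep_dim \<rho>)} \<or> W = carrier_vec (rep_dim \<rho>)"
  using assms unfolding irreducible_rep_def by blast

text \<open>The kernel and the image of an intertwiner are invariant, so a nonzero one is bijective. The
  dimensions agree since \<open>P Q\<close> and \<open>Q P\<close> have the same trace.\<close>

lemma schur_lemma:
  fixes \<rho> \<sigma> :: "'a::{finite, semigroup_mult} rep"
  assumes \<rho>: "irreducible_rep \<rho>" and \<sigma>: "irreducible_rep \<sigma>"
    and P: "P \<in> carrier_mat (rep_dim \<rho>) (rep_dim \<sigma>)"
    and com: "\<And>f. \<rho> f * P = P * \<sigma> f" and nz: "P \<noteq> 0\<^sub>m (rep_dim \<rho>) (rep_dim \<sigma>)"
  obtains Q where "rep_dim \<rho> = rep_dim \<sigma>" "Q \<in> carrier_mat (rep_dim \<sigma>) (rep_dim \<rho>)"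
    "P * Q = 1\<^sub>m (rep_dim \<rho>)" "Q * P = 1\<^sub>m (rep_dim \<sigma>)"
proof -
  define n where "n = rep_dim \<rho>"
  define m where "m = rep_dim \<sigma>"
  note r = representationD[OF irreducible_repD[OF \<rho>], folded n_def]
  note s = representationD[OF irreducible_repD[OF \<sigma>], folded m_def]
  have P: "P \<in> carrier_mat n m" using P by (simp add: n_def m_def)
  have comv: "\<rho> f *\<^sub>v (P *\<^sub>v v) = P *\<^sub>v (\<sigma> f *\<^sub>v v)" if "v \<in> carrier_vec m" for f v
    using assoc_mult_mat_vec[OF r(1) P that, of f] assoc_mult_mat_vec[OF P s(1) that, of f] com[of f] by simp
  have zero: "P *\<^sub>v 0\<^sub>v m = 0\<^sub>v n" using P by (intro eq_vecI) auto
  have nzv: "\<exists>v\<in>carrier_vec m. P *\<^sub>v v \<noteq> 0\<^sub>v n"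
  proof (rule ccontr)
    assume "\<not> ?thesis"
    then have "P = 0\<^sub>m n m" using P by (intro mat_eq_by_vec[of _ n m]) auto
    then show False using nz by (simp add: n_def m_def)
  qed
  define K where "K = {v \<in> carrier_vec m. P *\<^sub>v v = 0\<^sub>v n}"
  have "is_subspace m K"
    unfolding is_subspace_iff K_def using P zero
    by (auto simp: mult_add_distrib_mat_vec[of _ n m] mult_mat_vec[of _ n m])
  moreover have "\<sigma> f *\<^sub>v w \<in> K" if "w \<in> K" for f w
  proof -
    have w: "w \<in> carrier_vec m" "P *\<^sub>v w = 0\<^sub>v n" using that by (auto simp: K_def)
    have "\<rho> f *\<^sub>v 0\<^sub>v n = 0\<^sub>v n" using r(1)[of f] by (intro eq_vecI) auto
    then have "P *\<^sub>v (\<sigma> f *\<^sub>v w) = 0\<^sub>v n" using comv[OF w(1), of f] w(2) by simp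
    then show ?thesis using w(1) s(1)[of f] by (auto simp: K_def)
  qed
  ultimately have "K = {0\<^sub>v m} \<or> K = carrier_vec m"
    unfolding m_def by (rule irreducible_subspace[OF \<sigma>])
  then have K: "K = {0\<^sub>v m}" using nzv unfolding K_def by blast
  define I where "I = (\<lambda>v. P *\<^sub>v v) ` carrier_vec m"
  have "is_subspace n I"
    unfolding is_subspace_iff
  proof (intro conjI ballI allI)
    show "I \<subseteq> carrier_vec n" unfolding I_def using P by auto
    show "0\<^sub>v n \<in> I" unfolding I_def using zero by (metis imageI zero_carrier_vec)
    show "v + w \<in> I" if "v \<in> I" "w \<in> I" for v w
    proof -
      from that obtain v' w' where vw: "v' \<in> carrier_vec m" "w' \<in> carrier_vec m" "v = P *\<^sub>v v'" "w = P *\<^sub>v w'"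
        unfolding I_def by blast
      then have "v + w = P *\<^sub>v (v' + w')" using mult_add_distrib_mat_vec[OF P] by simp
      then show ?thesis unfolding I_def using vw(1,2) by (rule image_eqI[OF _ add_carrier_vec])
    qed
    show "c \<cdot>\<^sub>v v \<in> I" if "v \<in> I" for c v
    proof -
      from that obtain v' where v: "v' \<in> carrier_vec m" "v = P *\<^sub>v v'"
        unfolding I_def by blast
      then have "c \<cdot>\<^sub>v v = P *\<^sub>v (c \<cdot>\<^sub>v v')" using mult_mat_vec[OF P] by simp
      then show ?thesis unfolding I_def using v(1) by (intro image_eqI[where x = "c \<cdot>\<^sub>v v'"]) auto
    qed
  qed
  moreover have "\<rho> f *\<^sub>v w \<in> I" if "w \<in> I" for f w
  proof -
    from that obtain v where v: "v \<in> carrier_vec m" "w = P *\<^sub>v v"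
      unfolding I_def by blast
    then have "\<rho> f *\<^sub>v w = P *\<^sub>v (\<sigma> f *\<^sub>v v)" "\<sigma> f *\<^sub>v v \<in> carrier_vec m"
      using comv s(1)[of f] by auto
    then show ?thesis unfolding I_def by (rule image_eqI)
  qed
  ultimately have "I = {0\<^sub>v n} \<or> I = carrier_vec n"
    unfolding n_def by (rule irreducible_subspace[OF \<rho>])
  then have I: "I = carrier_vec n" using nzv unfolding I_def by blast
  have "\<exists>q. q \<in> carrier_vec m \<and> P *\<^sub>v q = unit_vec n i" for i
  proof -
    have "unit_vec n i \<in> I" unfolding I by simp
    then show ?thesis unfolding I_def by auto
  qed
  then obtain q where q: "\<And>i. q i \<in> carrier_vec m" "\<And>i. P *\<^sub>v q i = unit_vec n i" by metis
  define Q where "Q = mat m n (\<lambda>(i, j). q j $ i)"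
  have Q: "Q \<in> carrier_mat m n" by (simp add: Q_def)
  have Qc: "col Q j = q j" if "j < n" for j
    using that q(1)[of j] unfolding Q_def by (intro eq_vecI) auto
  have PQ: "P * Q = 1\<^sub>m n"
  proof (rule eq_matI)
    fix i j assume ij: "i < dim_row (1\<^sub>m n)" "j < dim_col (1\<^sub>m n)"
    then have "(P * Q) $$ (i, j) = (P *\<^sub>v q j) $ i" using P Q Qc by simp
    then show "(P * Q) $$ (i, j) = 1\<^sub>m n $$ (i, j)" using ij q(2)[of j] by simp
  qed (use P Q in auto)
  have QP: "Q * P = 1\<^sub>m m"
  proof (rule mat_eq_by_vec[of _ m m])
    fix v :: "complex vec" assume v: "v \<in> carrier_vec m"
    define u where "u = (Q * P) *\<^sub>v v"
    have u: "u \<in> carrier_vec m" unfolding u_def using P Q v by auto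
    have "P *\<^sub>v u = P *\<^sub>v (Q *\<^sub>v (P *\<^sub>v v))"
      unfolding u_def using assoc_mult_mat_vec[OF Q P v] by simp
    also have "\<dots> = (P * Q) *\<^sub>v (P *\<^sub>v v)"
      using assoc_mult_mat_vec[OF P Q, of "P *\<^sub>v v"] P v by simp
    also have "\<dots> = P *\<^sub>v v" unfolding PQ using P v by simp
    finally have "P *\<^sub>v (u - v) = 0\<^sub>v n"
      using mult_minus_distrib_mat_vec[OF P u v] P v by simp
    then have "u - v \<in> K" unfolding K_def using u v by simp
    then have uv: "u - v = 0\<^sub>v m" unfolding K by simp
    have "u = v"
    proof (rule eq_vecI)
      fix i assume "i < dim_vec v"
      then have "(u - v) $ i = 0" using v uv by simp
      then show "u $ i = v $ i" using u v \<open>i < dim_vec v\<close> by simp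
    qed (use u v in simp)
    then show "Q * P *\<^sub>v v = 1\<^sub>m m *\<^sub>v v" using v by (simp add: u_def)
  qed (use P Q in auto)
  have "of_nat n = mat_trace (P * Q)" unfolding PQ by (simp add: mat_trace_def)
  also have "\<dots> = mat_trace (Q * P)" by (rule mat_trace_comm[OF P Q])
  also have "\<dots> = of_nat m" unfolding QP by (simp add: mat_trace_def)
  finally have "n = m" using of_nat_eq_iff by blast
  then show thesis using that[of Q] Q PQ QP by (simp add: n_def m_def)
qed

lemma irreducible_dim_pos:
  assumes "irreducible_rep \<rho>" shows "0 < rep_dim \<rho>"
proof (rule ccontr)
  assume "\<not> 0 < rep_dim \<rho>"
  then have z: "rep_dim \<rho> = 0" by simp
  have "\<rho> f = 0\<^sub>m 0 0" for f
    using representationD(1)[OF irreducible_repD[OF assms], of f] unfolding z by auto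
  then show False using assms z unfolding irreducible_rep_def by auto
qed

text \<open>Subtracting an eigenvalue from a self-intertwiner gives an intertwiner with a kernel, which
  vanishes by Schur's lemma.\<close>

lemma schur_lemma_scalar:
  fixes \<rho> :: "'a::{finite, semigroup_mult} rep"
  assumes \<rho>: "irreducible_rep \<rho>"
    and P: "P \<in> carrier_mat (rep_dim \<rho>) (rep_dim \<rho>)"
    and com: "\<And>f. \<rho> f * P = P * \<rho> f"
  obtains c where "P = c \<cdot>\<^sub>m 1\<^sub>m (rep_dim \<rho>)"
proof -
  define n where "n = rep_dim \<rho>"
  have P: "P \<in> carrier_mat n n" using P by (simp add: n_def)
  note r = representationD[OF irreducible_repD[OF \<rho>], folded n_def]
  have "spectrum P \<noteq> {}"
    using P irreducible_dim_pos[OF \<rho>] by (intro spectrum_non_empty[of _ n]) (auto simp: n_def)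
  then obtain c v where v: "eigenvector P v c" by (auto simp: spectrum_def eigenvalue_def)
  define R where "R = P - c \<cdot>\<^sub>m 1\<^sub>m n"
  have R: "R \<in> carrier_mat n n" unfolding R_def by (rule minus_carrier_mat) simp
  have "R = char_matrix P c"
    using P by (intro eq_matI) (auto simp: R_def char_matrix_def)
  then have v: "v \<in> carrier_vec n" "v \<noteq> 0\<^sub>v n" and Rv: "R *\<^sub>v v = 0\<^sub>v n"
    using v P eigenvector_char_matrix[OF P] by auto
  have Rcom: "\<rho> f * R = R * \<rho> f" for f
    unfolding R_def using P r(1)[of f] com[of f]
    by (simp add: mult_minus_distrib_mat[of _ n n _ n] minus_mult_distrib_mat[of _ n n _ _ n] mult_smult_distrib[of _ n n _ n] mult_smult_assoc_mat[of _ n n _ n])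
  have "R = 0\<^sub>m n n"
  proof (rule ccontr)
    assume "R \<noteq> 0\<^sub>m n n"
    then obtain Q where Q: "Q \<in> carrier_mat n n" "Q * R = 1\<^sub>m n"
      using schur_lemma[OF \<rho> \<rho>, of R] R Rcom unfolding n_def by metis
    have "v = Q *\<^sub>v (R *\<^sub>v v)"
      using assoc_mult_mat_vec[OF Q(1) R v(1)] Q v by simp
    also have "\<dots> = 0\<^sub>v n" unfolding Rv using Q by (intro eq_vecI) auto
    finally show False using v by simp
  qed
  have "P = c \<cdot>\<^sub>m 1\<^sub>m n"
  proof (rule eq_matI)
    fix i j assume ij: "i < dim_row (c \<cdot>\<^sub>m 1\<^sub>m n)" "j < dim_col (c \<cdot>\<^sub>m 1\<^sub>m n)"
    have "R $$ (i, j) = 0" using \<open>R = 0\<^sub>m n n\<close> ij by simp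
    then show "P $$ (i, j) = (c \<cdot>\<^sub>m 1\<^sub>m n) $$ (i, j)" using ij P by (simp add: R_def)
  qed (use P in auto)
  then show thesis using that by (simp add: n_def)
qed


section \<open>Orthogonality of characters\<close>

lemma bij_betw_left_mult:
  fixes x :: "'a::inverse_semigroup"
  shows "bij_betw ((*) x) {u. sg_ran u = sg_dom x} {u. sg_ran u = sg_ran x}"
proof (rule bij_betw_byWitness[where f' = "(*) (sg_inv x)"])
  show "\<forall>u\<in>{u. sg_ran u = sg_dom x}. sg_inv x * (x * u) = u"
    by (metis (mono_tags, lifting) mem_Collect_eq mult.assoc ran_mult sg_dom_def)
  show "\<forall>u\<in>{u. sg_ran u = sg_ran x}. x * (sg_inv x * u) = u"
    by (metis (mono_tags, lifting) mem_Collect_eq mult.assoc ran_mult sg_ran_def)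
  show "(*) x ` {u. sg_ran u = sg_dom x} \<subseteq> {u. sg_ran u = sg_ran x}"
    by (auto simp: ran_comp)
  show "(*) (sg_inv x) ` {u. sg_ran u = sg_ran x} \<subseteq> {u. sg_ran u = sg_dom x}"
    by (auto simp: ran_comp)
qed

text \<open>The size of the Green \<open>\<R>\<close>-class of \<open>s\<close>, as a complex number because it serves as a weight.\<close>

definition rclass_size :: "'a::{finite, inverse_semigroup} \<Rightarrow> complex" where
  "rclass_size s = of_nat (card {u. sg_ran u = sg_ran s})"

lemma rclass_size_nz: "rclass_size s \<noteq> 0"
proof -
  have "s \<in> {u. sg_ran u = sg_ran s}" by simp
  then have "card {u. sg_ran u = sg_ran s} \<noteq> 0" using finite by (metis card_0_eq empty_iff)
  then show ?thesis unfolding rclass_size_def by (simp only: of_nat_eq_0_iff not_False_eq_True)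
qed

text \<open>Left multiplication by \<open>x\<close> identifies the elements with range \<open>dom x\<close> and those with range
  \<open>ran x\<close>, so the size is constant on \<open>\<D>\<close>-classes.\<close>

lemma rclass_size_transport:
  assumes "sg_dom x = sg_ran s" "sg_ran x = sg_ran t"
  shows "rclass_size s = rclass_size t"
  using bij_betw_same_card[OF bij_betw_left_mult[of x]] unfolding rclass_size_def assms
  by (rule arg_cong)

lemma rep_groupoid_basis_mult:
  assumes \<rho>: "representation \<rho>" and ij: "i < rep_dim \<rho>" "j < rep_dim \<rho>"
  shows "(\<Sum>k<rep_dim \<rho>. \<rho> (groupoid_basis u) $$ (i, k) * \<rho> (groupoid_basis t) $$ (k, j))
    = (if sg_dom u = sg_ran t then \<rho> (groupoid_basis (u * t)) $$ (i, j) else 0)"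
proof -
  have "(\<Sum>k<rep_dim \<rho>. \<rho> (groupoid_basis u) $$ (i, k) * \<rho> (groupoid_basis t) $$ (k, j))
    = (\<rho> (groupoid_basis u) * \<rho> (groupoid_basis t)) $$ (i, j)"
    using ij representationD(1)[OF \<rho>, of "groupoid_basis u"] representationD(1)[OF \<rho>, of "groupoid_basis t"]
    by (simp add: scalar_prod_def atLeast0LessThan)
  also have "\<dots> = \<rho> (sga_mult (groupoid_basis u) (groupoid_basis t)) $$ (i, j)"
    by (simp add: representationD(4)[OF \<rho>])
  finally show ?thesis
    using ij by (simp add: groupoid_basis_mult rep_zero[OF \<rho>])
qed

lemma rep_expansion:
  assumes \<rho>: "representation \<rho>" and ij: "i < rep_dim \<rho>" "j < rep_dim \<rho>"
  shows "\<rho> f $$ (i, j) = (\<Sum>t\<in>UNIV. zeta f t * \<rho> (groupoid_basis t) $$ (i, j))"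
proof -
  have "f = (\<lambda>u. \<Sum>t\<in>UNIV. zeta f t * groupoid_basis t u)" using zeta_expansion by blast
  then have "\<rho> f $$ (i, j) = \<rho> (\<lambda>u. \<Sum>t\<in>UNIV. zeta f t * groupoid_basis t u) $$ (i, j)" by simp
  then show ?thesis using rep_sum[OF \<rho> finite ij, where T = UNIV and c = "zeta f" and F = groupoid_basis] by simp
qed

text \<open>The weighted average \<open>\<Sum>t. \<rho>(\<lfloor>t\<rfloor>) E\<^sub>k\<^sub>l \<sigma>(\<lfloor>t\<^sup>-\<^sup>1\<rfloor>) / N(t)\<close> of the matrix unit \<open>E\<^sub>k\<^sub>l\<close>, written
  entrywise. Its entries are the pairings of the matrix coefficients of \<open>\<rho>\<close> and \<open>\<sigma>\<close>.\<close>

definition pairing_mat ::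
  "'a::{finite, inverse_semigroup} rep \<Rightarrow> 'a rep \<Rightarrow> nat \<Rightarrow> nat \<Rightarrow> complex mat" where
  "pairing_mat \<rho> \<sigma> k l = mat (rep_dim \<rho>) (rep_dim \<sigma>) (\<lambda>(i, j).
     \<Sum>t\<in>UNIV. \<rho> (groupoid_basis t) $$ (i, k) * \<sigma> (groupoid_basis (sg_inv t)) $$ (l, j) / rclass_size t)"

lemma pairing_mat_carrier: "pairing_mat \<rho> \<sigma> k l \<in> carrier_mat (rep_dim \<rho>) (rep_dim \<sigma>)"
  by (simp add: pairing_mat_def)

text \<open>For a basis element \<open>\<lfloor>u\<rfloor>\<close>, the two products are sums over the \<open>t\<close> with range \<open>dom u\<close> and with
  range \<open>ran u\<close>. The substitution \<open>t \<mapsto> u t\<close> identifies them, and it preserves the weights.\<close>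

lemma pairing_mat_intertwines:
  fixes \<rho> \<sigma> :: "'a::{finite, inverse_semigroup} rep"
  assumes \<rho>: "representation \<rho>" and \<sigma>: "representation \<sigma>"
    and kl: "k < rep_dim \<rho>" "l < rep_dim \<sigma>"
  shows "\<rho> f * pairing_mat \<rho> \<sigma> k l = pairing_mat \<rho> \<sigma> k l * \<sigma> f"
proof (rule eq_matI)
  let ?T = "pairing_mat \<rho> \<sigma> k l"
  let ?r = "\<lambda>t. \<rho> (groupoid_basis t)" and ?s = "\<lambda>t. \<sigma> (groupoid_basis t)"
  have rd: "dim_row (\<rho> f) = rep_dim \<rho>" "dim_col (\<rho> f) = rep_dim \<rho>" for f
    using representationD(1)[OF \<rho>, of f] by auto
  have sd: "dim_row (\<sigma> f) = rep_dim \<sigma>" "dim_col (\<sigma> f) = rep_dim \<sigma>" for f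
    using representationD(1)[OF \<sigma>, of f] by auto
  show "dim_row (\<rho> f * ?T) = dim_row (?T * \<sigma> f)" "dim_col (\<rho> f * ?T) = dim_col (?T * \<sigma> f)"
    by (simp_all add: rd sd pairing_mat_def)
  fix i j assume "i < dim_row (?T * \<sigma> f)" "j < dim_col (?T * \<sigma> f)"
  then have i: "i < rep_dim \<rho>" and j: "j < rep_dim \<sigma>" by (simp_all add: pairing_mat_def sd)
  have left: "(\<Sum>m<rep_dim \<rho>. ?r u $$ (i, m) * ?T $$ (m, j))
    = (\<Sum>t | sg_ran t = sg_dom u. ?r (u * t) $$ (i, k) * ?s (sg_inv t) $$ (l, j) / rclass_size t)" for u
  proof -
    have "(\<Sum>m<rep_dim \<rho>. ?r u $$ (i, m) * ?T $$ (m, j))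
      = (\<Sum>m<rep_dim \<rho>. \<Sum>t\<in>UNIV. ?r u $$ (i, m) * ?r t $$ (m, k) * (?s (sg_inv t) $$ (l, j) / rclass_size t))"
      using j by (intro sum.cong refl) (simp add: pairing_mat_def sum_distrib_left mult.assoc)
    also have "\<dots> = (\<Sum>t\<in>UNIV. (\<Sum>m<rep_dim \<rho>. ?r u $$ (i, m) * ?r t $$ (m, k)) * (?s (sg_inv t) $$ (l, j) / rclass_size t))"
      unfolding sum_distrib_right by (rule sum.swap)
    also have "\<dots> = (\<Sum>t\<in>UNIV. if sg_ran t = sg_dom u then ?r (u * t) $$ (i, k) * ?s (sg_inv t) $$ (l, j) / rclass_size t else 0)"
      by (intro sum.cong refl) (simp add: rep_groupoid_basis_mult[OF \<rho> i kl(1)])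
    finally show ?thesis by (simp add: sum.If_cases)
  qed
  have right: "(\<Sum>m<rep_dim \<sigma>. ?T $$ (i, m) * ?s u $$ (m, j))
    = (\<Sum>t | sg_ran t = sg_ran u. ?r t $$ (i, k) * ?s (sg_inv t * u) $$ (l, j) / rclass_size t)" for u
  proof -
    have "(\<Sum>m<rep_dim \<sigma>. ?T $$ (i, m) * ?s u $$ (m, j))
      = (\<Sum>m<rep_dim \<sigma>. \<Sum>t\<in>UNIV. (?r t $$ (i, k) / rclass_size t) * (?s (sg_inv t) $$ (l, m) * ?s u $$ (m, j)))"
      using i by (intro sum.cong refl) (simp add: pairing_mat_def sum_distrib_right mult.assoc)
    also have "\<dots> = (\<Sum>t\<in>UNIV. (?r t $$ (i, k) / rclass_size t) * (\<Sum>m<rep_dim \<sigma>. ?s (sg_inv t) $$ (l, m) * ?s u $$ (m, j)))"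
      unfolding sum_distrib_left by (rule sum.swap)
    also have "\<dots> = (\<Sum>t\<in>UNIV. if sg_ran t = sg_ran u then ?r t $$ (i, k) * ?s (sg_inv t * u) $$ (l, j) / rclass_size t else 0)"
      by (intro sum.cong refl) (simp add: rep_groupoid_basis_mult[OF \<sigma> kl(2) j])
    finally show ?thesis by (simp add: sum.If_cases)
  qed
  have basis: "(\<Sum>m<rep_dim \<rho>. ?r u $$ (i, m) * ?T $$ (m, j)) = (\<Sum>m<rep_dim \<sigma>. ?T $$ (i, m) * ?s u $$ (m, j))" for u
    unfolding left right
  proof (subst sum.reindex_bij_betw[OF bij_betw_left_mult, symmetric], intro sum.cong refl)
    fix t assume "t \<in> {t. sg_ran t = sg_dom u}"
    then have t: "sg_ran t = sg_dom u" by simp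
    have "sg_inv (u * t) * u = sg_inv t * sg_dom u" by (simp add: sg_inv_mult sg_dom_def mult.assoc)
    also have "\<dots> = sg_inv t" using mult_dom[of "sg_inv t"] t by simp
    finally have "sg_inv (u * t) * u = sg_inv t" .
    moreover have "rclass_size (u * t) = rclass_size t"
      using rclass_size_transport[of u t "u * t"] t ran_comp[of u t] by simp
    ultimately show "?r (u * t) $$ (i, k) * ?s (sg_inv t) $$ (l, j) / rclass_size t
      = ?r (u * t) $$ (i, k) * ?s (sg_inv (u * t) * u) $$ (l, j) / rclass_size (u * t)" by simp
  qed
  have "(\<rho> f * ?T) $$ (i, j) = (\<Sum>m<rep_dim \<rho>. \<rho> f $$ (i, m) * ?T $$ (m, j))"
    using i j by (simp add: rd scalar_prod_def atLeast0LessThan pairing_mat_def)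
  also have "\<dots> = (\<Sum>m<rep_dim \<rho>. \<Sum>u\<in>UNIV. zeta f u * (?r u $$ (i, m) * ?T $$ (m, j)))"
    using i by (intro sum.cong refl) (simp add: rep_expansion[OF \<rho>, of _ _ f] sum_distrib_right mult.assoc)
  also have "\<dots> = (\<Sum>u\<in>UNIV. zeta f u * (\<Sum>m<rep_dim \<rho>. ?r u $$ (i, m) * ?T $$ (m, j)))"
    unfolding sum_distrib_left by (rule sum.swap)
  also have "\<dots> = (\<Sum>u\<in>UNIV. zeta f u * (\<Sum>m<rep_dim \<sigma>. ?T $$ (i, m) * ?s u $$ (m, j)))"
    unfolding basis ..
  also have "\<dots> = (\<Sum>m<rep_dim \<sigma>. \<Sum>u\<in>UNIV. zeta f u * (?T $$ (i, m) * ?s u $$ (m, j)))"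
    unfolding sum_distrib_left by (rule sum.swap)
  also have "\<dots> = (\<Sum>m<rep_dim \<sigma>. ?T $$ (i, m) * \<sigma> f $$ (m, j))"
    using j by (intro sum.cong refl) (simp add: rep_expansion[OF \<sigma>, of _ _ f] sum_distrib_left mult.left_commute)
  also have "\<dots> = (?T * \<sigma> f) $$ (i, j)"
    using i j by (simp add: sd scalar_prod_def atLeast0LessThan pairing_mat_def)
  finally show "(\<rho> f * ?T) $$ (i, j) = (?T * \<sigma> f) $$ (i, j)" .
qed

lemma pairing_mat_inequivalent:
  fixes \<rho> \<sigma> :: "'a::{finite, inverse_semigroup} rep"
  assumes \<rho>: "irreducible_rep \<rho>" and \<sigma>: "irreducible_rep \<sigma>"
    and ne: "\<not> equivalent_rep \<rho> \<sigma>" and kl: "k < rep_dim \<rho>" "l < rep_dim \<sigma>"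
  shows "pairing_mat \<rho> \<sigma> k l = 0\<^sub>m (rep_dim \<rho>) (rep_dim \<sigma>)"
proof (rule ccontr)
  let ?P = "pairing_mat \<rho> \<sigma> k l"
  note r = irreducible_repD[OF \<rho>] and s = irreducible_repD[OF \<sigma>]
  note com = pairing_mat_intertwines[OF r s kl]
  assume "?P \<noteq> 0\<^sub>m (rep_dim \<rho>) (rep_dim \<sigma>)"
  from schur_lemma[OF \<rho> \<sigma> pairing_mat_carrier com this] obtain Q where
    d: "rep_dim \<rho> = rep_dim \<sigma>" and Q: "Q \<in> carrier_mat (rep_dim \<sigma>) (rep_dim \<rho>)"
    "?P * Q = 1\<^sub>m (rep_dim \<rho>)" "Q * ?P = 1\<^sub>m (rep_dim \<sigma>)" .
  let ?n = "rep_dim \<sigma>"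
  have P: "?P \<in> carrier_mat ?n ?n" using pairing_mat_carrier[of \<rho> \<sigma> k l] d by simp
  have "similar_mat_wit (\<rho> f) (\<sigma> f) ?P Q" for f
  proof -
    have f: "\<rho> f \<in> carrier_mat ?n ?n" "\<sigma> f \<in> carrier_mat ?n ?n"
      using representationD(1)[OF r, of f] representationD(1)[OF s, of f] d by auto
    have "?P * \<sigma> f * Q = \<rho> f * (?P * Q)"
      unfolding com[symmetric] using f P Q d by (intro assoc_mult_mat) auto
    then have "\<rho> f = ?P * \<sigma> f * Q" using f Q d by simp
    then show ?thesis using f P Q d by (auto simp: similar_mat_wit_def Let_def)
  qed
  then show False using ne unfolding equivalent_rep_def by blast
qed

text \<open>The identity of the algebra. The factor \<open>1\<close> gives the sum the shape of a linear combination
  to which \<open>zeta_sum\<close> and \<open>rep_sum\<close> apply.\<close>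

definition sga_one :: "'a::{finite, inverse_semigroup} \<Rightarrow> complex" where
  "sga_one u = (\<Sum>e | idem e. 1 * groupoid_basis e u)"

lemma zeta_sga_one: "zeta sga_one w = (if idem w then 1 else 0)"
proof -
  have "zeta sga_one w = (\<Sum>e | idem e. 1 * zeta (groupoid_basis e) w)"
    unfolding sga_one_def[abs_def] by (rule zeta_sum)
  then show ?thesis by (simp add: zeta_groupoid_basis)
qed

lemma zeta_inject:
  assumes "\<And>w. zeta f w = zeta h w" shows "f = h"
proof
  fix u
  have "f u = (\<Sum>t\<in>UNIV. zeta f t * groupoid_basis t u)" by (rule zeta_expansion)
  also have "\<dots> = h u" unfolding assms by (rule zeta_expansion[symmetric])
  finally show "f u = h u" .
qed

lemma idem_mult_inv_iff:
  assumes "sg_dom v = sg_dom (w::'a::inverse_semigroup)"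
  shows "idem (w * sg_inv v) \<longleftrightarrow> v = w"
proof
  assume "idem (w * sg_inv v)"
  then have "nat_le (w * sg_inv v * v) v" by (rule idem_mult_nat_le)
  moreover have "w * sg_inv v * v = w"
    using mult_dom[of w] assms by (simp add: sg_dom_def mult.assoc)
  ultimately have "nat_le w v" by simp
  then have "w = v * sg_dom w" by (rule nat_le_eq_mult_dom)
  also have "\<dots> = v" using assms[symmetric] by simp
  finally show "v = w" by (rule sym)
qed simp

lemma sga_one_mult: "sga_mult sga_one f = f" and sga_mult_one: "sga_mult f sga_one = f"
proof -
  show "sga_mult sga_one f = f"
  proof (rule zeta_inject)
    fix w
    have "zeta (sga_mult sga_one f) w = (\<Sum>v | sg_dom v = sg_dom w. if v = w then zeta f v else 0)"
      unfolding zeta_sga_mult by (intro sum.cong refl) (simp add: zeta_sga_one idem_mult_inv_iff)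
    then show "zeta (sga_mult sga_one f) w = zeta f w" by simp
  qed
  show "sga_mult f sga_one = f"
  proof (rule zeta_inject)
    fix w
    have "zeta (sga_mult f sga_one) w = (\<Sum>v | sg_dom v = sg_dom w. if v = sg_dom w then zeta f w else 0)"
      unfolding zeta_sga_mult
      by (intro sum.cong refl) (auto simp: zeta_sga_one dom_idem sg_inv_idem)
    then show "zeta (sga_mult f sga_one) w = zeta f w" by (simp add: dom_idem)
  qed
qed

text \<open>Representations are not assumed unital, but the image of the identity of the algebra is scalar
  by Schur's lemma and acts trivially on some nonzero \<open>\<rho>(f)\<close>.\<close>

lemma rep_one:
  fixes \<rho> :: "'a::{finite, inverse_semigroup} rep"
  assumes \<rho>: "irreducible_rep \<rho>" shows "\<rho> sga_one = 1\<^sub>m (rep_dim \<rho>)"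
proof -
  note r = representationD[OF irreducible_repD[OF \<rho>]]
  have "\<rho> f * \<rho> sga_one = \<rho> sga_one * \<rho> f" for f
    by (simp add: r(4)[symmetric] sga_one_mult sga_mult_one)
  then obtain c where c: "\<rho> sga_one = c \<cdot>\<^sub>m 1\<^sub>m (rep_dim \<rho>)" using schur_lemma_scalar[OF \<rho> r(1)] by metis
  obtain f where f: "\<rho> f \<noteq> 0\<^sub>m (rep_dim \<rho>) (rep_dim \<rho>)" using \<rho> unfolding irreducible_rep_def by blast
  then obtain i j where ij: "i < rep_dim \<rho>" "j < rep_dim \<rho>" "\<rho> f $$ (i, j) \<noteq> 0"
    using r(1)[of f] by (metis eq_matI carrier_matD index_zero_mat)
  have "\<rho> f = \<rho> sga_one * \<rho> f" by (simp add: r(4)[symmetric] sga_one_mult)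
  also have "\<dots> = c \<cdot>\<^sub>m \<rho> f"
    unfolding c using r(1)[of f] by (simp add: mult_smult_assoc_mat[of _ "rep_dim \<rho>" "rep_dim \<rho>" _ "rep_dim \<rho>"])
  finally have "\<rho> f $$ (i, j) = c * \<rho> f $$ (i, j)" using ij r(1)[of f] by (metis carrier_matD index_smult_mat(1))
  then have "c = 1" using ij(3) by simp
  then show ?thesis unfolding c by (intro eq_matI) auto
qed

text \<open>For an idempotent \<open>e\<close>, inversion puts the elements with domain \<open>e\<close> in bijection with those
  with range \<open>e\<close>, and each of them has weight \<open>1 / N(e)\<close>.\<close>

lemma sum_over_domains:
  fixes h :: "'a::{finite, inverse_semigroup} \<Rightarrow> complex"
  shows "(\<Sum>t\<in>UNIV. h (sg_dom t) / rclass_size t) = (\<Sum>e | idem e. h e)"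
proof -
  let ?F = "\<lambda>t. h (sg_dom t) / rclass_size t"
  have "sum ?F UNIV = (\<Sum>e\<in>Collect idem. sum ?F {t \<in> UNIV. sg_dom t = e})"
  proof (rule sum.group[symmetric])
    show "sg_dom ` UNIV \<subseteq> Collect (idem :: 'a \<Rightarrow> bool)"
      by (rule image_subsetI, rule CollectI, rule idem_dom)
  qed (rule finite)+
  also have "\<dots> = (\<Sum>e | idem e. h e)"
  proof (intro sum.cong refl)
    fix e :: 'a assume "e \<in> {e. idem e}"
    then have e: "idem e" by simp
    have "rclass_size t = rclass_size e" if "sg_dom t = e" for t
      using rclass_size_transport[of "sg_inv t" t e] that e by (simp add: ran_idem)
    then have "(\<Sum>t\<in>{t \<in> UNIV. sg_dom t = e}. h (sg_dom t) / rclass_size t)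
        = of_nat (card {t. sg_dom t = e}) * (h e / rclass_size e)" by simp
    also have "card {t. sg_dom t = e} = card {t. sg_ran t = sg_ran e}"
      by (rule bij_betw_same_card[of sg_inv], rule bij_betw_byWitness[where f' = sg_inv])
        (use e in \<open>auto simp: ran_idem\<close>)
    finally show "(\<Sum>t\<in>{t \<in> UNIV. sg_dom t = e}. h (sg_dom t) / rclass_size t) = h e"
      unfolding rclass_size_def[of e, symmetric] using rclass_size_nz[of e] by simp
  qed
  finally show ?thesis .
qed

text \<open>By Schur's lemma this matrix is scalar. Its trace is an entry of
  \<open>\<Sum>t. \<rho>(\<lfloor>t\<^sup>-\<^sup>1\<rfloor>) \<rho>(\<lfloor>t\<rfloor>) / N(t) = \<rho>(1)\<close>, which determines the scalar.\<close>

lemma pairing_mat_self: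
  fixes \<rho> :: "'a::{finite, inverse_semigroup} rep"
  assumes \<rho>: "irreducible_rep \<rho>" and kl: "k < rep_dim \<rho>" "l < rep_dim \<rho>"
  shows "pairing_mat \<rho> \<rho> k l = (if k = l then 1 / of_nat (rep_dim \<rho>) else 0) \<cdot>\<^sub>m 1\<^sub>m (rep_dim \<rho>)"
proof -
  let ?n = "rep_dim \<rho>" and ?r = "\<lambda>t. \<rho> (groupoid_basis t)"
  note r = irreducible_repD[OF \<rho>]
  obtain c where c: "pairing_mat \<rho> \<rho> k l = c \<cdot>\<^sub>m 1\<^sub>m ?n"
    using schur_lemma_scalar[OF \<rho> pairing_mat_carrier pairing_mat_intertwines[OF r r kl]] by metis
  have "of_nat ?n * c = (\<Sum>i<?n. pairing_mat \<rho> \<rho> k l $$ (i, i))" unfolding c by simp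
  also have "\<dots> = (\<Sum>i<?n. \<Sum>t\<in>UNIV. ?r (sg_inv t) $$ (l, i) * ?r t $$ (i, k) / rclass_size t)"
    by (simp add: pairing_mat_def mult.commute)
  also have "\<dots> = (\<Sum>t\<in>UNIV. (\<Sum>i<?n. ?r (sg_inv t) $$ (l, i) * ?r t $$ (i, k)) / rclass_size t)"
    unfolding sum_divide_distrib by (rule sum.swap)
  also have "\<dots> = (\<Sum>t\<in>UNIV. ?r (sg_dom t) $$ (l, k) / rclass_size t)"
    by (simp add: rep_groupoid_basis_mult[OF r kl(2,1)] sg_dom_def[symmetric])
  also have "\<dots> = (\<Sum>e | idem e. ?r e $$ (l, k))" by (rule sum_over_domains)
  also have "\<dots> = \<rho> sga_one $$ (l, k)"
    unfolding sga_one_def[abs_def] using rep_sum[OF r finite kl(2,1), where T = "Collect idem" and c = "\<lambda>_. 1" and F = groupoid_basis] by simp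
  also have "\<dots> = (if k = l then 1 else 0)" using kl by (simp add: rep_one[OF \<rho>])
  finally have "c = (if k = l then 1 / of_nat ?n else 0)"
    using irreducible_dim_pos[OF \<rho>] by (auto simp: field_simps)
  then show ?thesis using c by simp
qed

lemma character_pairing:
  fixes \<rho> \<sigma> :: "'a::{finite, inverse_semigroup} rep"
  assumes \<rho>: "representation \<rho>" and \<sigma>: "representation \<sigma>"
  shows "(\<Sum>t\<in>UNIV. mat_trace (\<rho> (groupoid_basis t)) * mat_trace (\<sigma> (groupoid_basis (sg_inv t))) / rclass_size t)
    = (\<Sum>i<rep_dim \<rho>. \<Sum>j<rep_dim \<sigma>. pairing_mat \<rho> \<sigma> i j $$ (i, j))"
proof -
  let ?r = "\<lambda>t. \<rho> (groupoid_basis t)" and ?s = "\<lambda>t. \<sigma> (groupoid_basis t)"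
  have d: "dim_row (\<rho> f) = rep_dim \<rho>" "dim_row (\<sigma> f) = rep_dim \<sigma>" for f
    using representationD(1)[OF \<rho>, of f] representationD(1)[OF \<sigma>, of f] by auto
  have "(\<Sum>t\<in>UNIV. mat_trace (?r t) * mat_trace (?s (sg_inv t)) / rclass_size t)
    = (\<Sum>t\<in>UNIV. \<Sum>x\<in>{..<rep_dim \<rho>} \<times> {..<rep_dim \<sigma>}. ?r t $$ (fst x, fst x) * ?s (sg_inv t) $$ (snd x, snd x) / rclass_size t)"
    by (simp add: mat_trace_def d sum_product sum.cartesian_product sum_divide_distrib case_prod_unfold)
  also have "\<dots> = (\<Sum>x\<in>{..<rep_dim \<rho>} \<times> {..<rep_dim \<sigma>}. \<Sum>t\<in>UNIV. ?r t $$ (fst x, fst x) * ?s (sg_inv t) $$ (snd x, snd x) / rclass_size t)"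
    by (rule sum.swap)
  also have "\<dots> = (\<Sum>x\<in>{..<rep_dim \<rho>} \<times> {..<rep_dim \<sigma>}. pairing_mat \<rho> \<sigma> (fst x) (snd x) $$ (fst x, snd x))"
    by (intro sum.cong refl) (auto simp: pairing_mat_def)
  finally show ?thesis by (simp add: sum.cartesian_product case_prod_unfold)
qed

lemma character_orthogonality:
  fixes \<rho> \<sigma> :: "'a::{finite, inverse_semigroup} rep"
  assumes \<rho>: "irreducible_rep \<rho>" and \<sigma>: "irreducible_rep \<sigma>"
  shows "\<not> equivalent_rep \<rho> \<sigma> \<Longrightarrow>
      (\<Sum>t\<in>UNIV. mat_trace (\<rho> (groupoid_basis t)) * mat_trace (\<sigma> (groupoid_basis (sg_inv t))) / rclass_size t) = 0"
    and "(\<Sum>t\<in>UNIV. mat_trace (\<rho> (groupoid_basis t)) * mat_trace (\<rho> (groupoid_basis (sg_inv t))) / rclass_size t) = 1"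
proof -
  note r = irreducible_repD[OF \<rho>] and s = irreducible_repD[OF \<sigma>]
  show "(\<Sum>t\<in>UNIV. mat_trace (\<rho> (groupoid_basis t)) * mat_trace (\<sigma> (groupoid_basis (sg_inv t))) / rclass_size t) = 0"
    if "\<not> equivalent_rep \<rho> \<sigma>"
    unfolding character_pairing[OF r s]
    by (intro sum.neutral ballI) (simp add: pairing_mat_inequivalent[OF \<rho> \<sigma> that])
  have "(\<Sum>i<rep_dim \<rho>. \<Sum>j<rep_dim \<rho>. pairing_mat \<rho> \<rho> i j $$ (i, j))
    = (\<Sum>i<rep_dim \<rho>. \<Sum>j<rep_dim \<rho>. if i = j then 1 / of_nat (rep_dim \<rho>) else 0)"
    by (intro sum.cong refl) (simp add: pairing_mat_self[OF \<rho>])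
  then show "(\<Sum>t\<in>UNIV. mat_trace (\<rho> (groupoid_basis t)) * mat_trace (\<rho> (groupoid_basis (sg_inv t))) / rclass_size t) = 1"
    unfolding character_pairing[OF r r] using irreducible_dim_pos[OF \<rho>] by simp
qed


section \<open>The regular representation\<close>

text \<open>The matrix entries of the left regular representation in the groupoid basis: the product of
  \<open>f\<close> and \<open>\<lfloor>y\<rfloor>\<close> has coefficient \<open>regular_kernel f x y\<close> at \<open>\<lfloor>x\<rfloor>\<close>.\<close>

definition regular_kernel :: "('a::{finite, inverse_semigroup} \<Rightarrow> complex) \<Rightarrow> 'a \<Rightarrow> 'a \<Rightarrow> complex" where
  "regular_kernel f x y = (if sg_dom x = sg_dom y then zeta f (x * sg_inv y) else 0)"

lemma regular_kernel_mult:
  "regular_kernel (sga_mult f h) x z = (\<Sum>y\<in>UNIV. regular_kernel f x y * regular_kernel h y z)"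
proof (cases "sg_dom x = sg_dom z")
  case False
  then have "regular_kernel f x y * regular_kernel h y z = 0" for y
    by (auto simp: regular_kernel_def)
  then show ?thesis using False by (simp add: regular_kernel_def)
next
  case True
  \<comment> \<open>The groupoid convolution at \<open>x z\<^sup>-\<^sup>1\<close> is reindexed by \<open>v = y z\<^sup>-\<^sup>1\<close>.\<close>
  have bij: "bij_betw (\<lambda>y. y * sg_inv z) {y. sg_dom y = sg_dom z} {v. sg_dom v = sg_ran z}"
  proof (rule bij_betw_byWitness[where f' = "\<lambda>v. v * z"])
    show "\<forall>y\<in>{y. sg_dom y = sg_dom z}. y * sg_inv z * z = y"
    proof
      fix y assume "y \<in> {y. sg_dom y = sg_dom z}"
      then show "y * sg_inv z * z = y" using mult_dom[of y] by (simp add: mult.assoc sg_dom_def)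
    qed
    show "\<forall>v\<in>{v. sg_dom v = sg_ran z}. v * z * sg_inv z = v"
    proof
      fix v assume "v \<in> {v. sg_dom v = sg_ran z}"
      then show "v * z * sg_inv z = v" using mult_dom[of v] by (simp add: mult.assoc sg_ran_def)
    qed
    show "(\<lambda>y. y * sg_inv z) ` {y. sg_dom y = sg_dom z} \<subseteq> {v. sg_dom v = sg_ran z}"
      by (auto simp: dom_comp)
    show "(\<lambda>v. v * z) ` {v. sg_dom v = sg_ran z} \<subseteq> {y. sg_dom y = sg_dom z}"
      by (auto simp: dom_comp)
  qed
  have "sg_dom (x * sg_inv z) = sg_ran z" using True dom_comp[of x "sg_inv z"] by simp
  then have "regular_kernel (sga_mult f h) x z
    = (\<Sum>v | sg_dom v = sg_ran z. zeta f (x * sg_inv z * sg_inv v) * zeta h v)"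
    using True by (simp add: regular_kernel_def zeta_sga_mult)
  also have "\<dots> = (\<Sum>y | sg_dom y = sg_dom z. zeta f (x * sg_inv z * sg_inv (y * sg_inv z)) * zeta h (y * sg_inv z))"
    by (rule sum.reindex_bij_betw[OF bij, symmetric])
  also have "\<dots> = (\<Sum>y | sg_dom y = sg_dom z. regular_kernel f x y * regular_kernel h y z)"
  proof (intro sum.cong refl)
    fix y assume "y \<in> {y. sg_dom y = sg_dom z}"
    then have y: "sg_dom y = sg_dom z" by simp
    have "x * sg_inv z * sg_inv (y * sg_inv z) = x * sg_dom z * sg_inv y"
      by (simp add: sg_inv_mult sg_dom_def mult.assoc)
    also have "\<dots> = x * sg_inv y" unfolding True[symmetric] by simp
    finally show "zeta f (x * sg_inv z * sg_inv (y * sg_inv z)) * zeta h (y * sg_inv z)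
      = regular_kernel f x y * regular_kernel h y z"
      using True y by (simp add: regular_kernel_def)
  qed
  also have "\<dots> = (\<Sum>y\<in>UNIV. regular_kernel f x y * regular_kernel h y z)"
    by (intro sum.mono_neutral_left) (auto simp: regular_kernel_def)
  finally show ?thesis .
qed

lemma regular_representation:
  obtains R :: "'a::{finite, inverse_semigroup} rep"
  where "representation R" "\<And>f. mat_trace (R f) = (\<Sum>y\<in>UNIV. zeta f (sg_ran y))"
proof -
  obtain \<phi> where \<phi>: "bij_betw \<phi> {0..<card (UNIV :: 'a set)} (UNIV :: 'a set)"
    using ex_bij_betw_nat_finite[OF finite] by blast
  define n where "n = card (UNIV :: 'a set)"
  define R :: "'a rep" where "R = (\<lambda>f. mat n n (\<lambda>(i, j). regular_kernel f (\<phi> i) (\<phi> j)))"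
  have dim: "rep_dim R = n" by (simp add: rep_dim_def R_def)
  have "R (sga_mult f h) = R f * R h" for f h
  proof (rule eq_matI)
    fix i j assume "i < dim_row (R f * R h)" "j < dim_col (R f * R h)"
    then have ij: "i < n" "j < n" by (simp_all add: R_def)
    have "(R f * R h) $$ (i, j) = (\<Sum>k\<in>{0..<n}. regular_kernel f (\<phi> i) (\<phi> k) * regular_kernel h (\<phi> k) (\<phi> j))"
      using ij by (simp add: R_def scalar_prod_def)
    also have "\<dots> = (\<Sum>y\<in>UNIV. regular_kernel f (\<phi> i) y * regular_kernel h y (\<phi> j))"
      unfolding n_def by (rule sum.reindex_bij_betw[OF \<phi>])
    finally show "R (sga_mult f h) $$ (i, j) = (R f * R h) $$ (i, j)"
      using ij by (simp add: R_def regular_kernel_mult)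
  qed (simp_all add: R_def)
  moreover have "R (sga_add f h) = R f + R h" for f h
    by (rule eq_matI)
      (auto simp: R_def regular_kernel_def zeta_def sga_add_def sum.distrib)
  moreover have "R (sga_scale c f) = c \<cdot>\<^sub>m R f" for c f
    by (rule eq_matI)
      (auto simp: R_def regular_kernel_def zeta_def sga_scale_def sum_distrib_left)
  ultimately have "representation R"
    unfolding representation_def dim by (simp add: R_def)
  moreover have "mat_trace (R f) = (\<Sum>y\<in>UNIV. zeta f (sg_ran y))" for f
  proof -
    have "mat_trace (R f) = (\<Sum>i\<in>{0..<n}. zeta f (sg_ran (\<phi> i)))"
      by (simp add: mat_trace_def R_def regular_kernel_def sg_ran_def atLeast0LessThan)
    also have "\<dots> = (\<Sum>y\<in>UNIV. zeta f (sg_ran y))"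
      unfolding n_def by (rule sum.reindex_bij_betw[OF \<phi>])
    finally show ?thesis .
  qed
  ultimately show thesis by (rule that)
qed

lemma equivalent_rep_trace:
  assumes "equivalent_rep \<rho> \<sigma>" shows "mat_trace (\<rho> f) = mat_trace (\<sigma> f)"
proof -
  obtain P Q where "similar_mat_wit (\<rho> f) (\<sigma> f) P Q" using assms unfolding equivalent_rep_def by blast
  then obtain n where n: "\<rho> f \<in> carrier_mat n n" "\<sigma> f \<in> carrier_mat n n" "P \<in> carrier_mat n n"
    "Q \<in> carrier_mat n n" "Q * P = 1\<^sub>m n" "\<rho> f = P * \<sigma> f * Q"
    unfolding similar_mat_wit_def Let_def by auto
  have "mat_trace (\<rho> f) = mat_trace (Q * (P * \<sigma> f))"
    unfolding n(6) using n by (intro mat_trace_comm[of _ n n]) auto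
  also have "Q * (P * \<sigma> f) = \<sigma> f"
    using n assoc_mult_mat[of Q n n P n "\<sigma> f" n] by simp
  finally show ?thesis .
qed

lemma equivalent_rep_refl:
  assumes "representation \<rho>" shows "equivalent_rep \<rho> \<rho>"
  unfolding equivalent_rep_def
proof (intro exI allI)
  fix f
  show "similar_mat_wit (\<rho> f) (\<rho> f) (1\<^sub>m (rep_dim \<rho>)) (1\<^sub>m (rep_dim \<rho>))"
    using representationD(1)[OF assms, of f] by (auto simp: similar_mat_wit_def Let_def)
qed

text \<open>The regular character vanishes at \<open>\<lfloor>t\<rfloor>\<close> unless \<open>t\<close> is idempotent, and then it cancels the weight
  \<open>1 / N(t)\<close>. What remains is the trace of \<open>\<sigma>(1)\<close>.\<close>

lemma regular_character_pairing:
  fixes \<sigma> :: "'a::{finite, inverse_semigroup} rep"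
  assumes \<sigma>: "irreducible_rep \<sigma>"
  shows "(\<Sum>t\<in>UNIV. (\<Sum>y\<in>UNIV. zeta (groupoid_basis t) (sg_ran y))
      * mat_trace (\<sigma> (groupoid_basis (sg_inv t))) / rclass_size t) = of_nat (rep_dim \<sigma>)"
proof -
  have "(\<Sum>y\<in>UNIV. zeta (groupoid_basis t) (sg_ran y)) * mat_trace (\<sigma> (groupoid_basis (sg_inv t))) / rclass_size t
    = (if idem t then mat_trace (\<sigma> (groupoid_basis t)) else 0)" for t
  proof -
    have n: "(\<Sum>y\<in>UNIV. zeta (groupoid_basis t) (sg_ran y)) = of_nat (card {y. sg_ran y = t})"
      by (simp add: zeta_groupoid_basis sum.If_cases)
    show ?thesis
    proof (cases "idem t")
      case True
      then have "rclass_size t = of_nat (card {y. sg_ran y = t})" by (simp add: rclass_size_def ran_idem)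
      then show ?thesis unfolding n using True rclass_size_nz[of t] by (simp add: sg_inv_idem)
    next
      case False
      then have "{y. sg_ran y = t} = {}" using idem_ran by blast
      then show ?thesis unfolding n using False by (simp only: card.empty) simp
    qed
  qed
  then have "(\<Sum>t\<in>UNIV. (\<Sum>y\<in>UNIV. zeta (groupoid_basis t) (sg_ran y))
      * mat_trace (\<sigma> (groupoid_basis (sg_inv t))) / rclass_size t)
    = (\<Sum>t\<in>UNIV. if idem t then mat_trace (\<sigma> (groupoid_basis t)) else 0)" by simp
  also have "\<dots> = (\<Sum>t\<in>Collect idem. 1 * mat_trace (\<sigma> (groupoid_basis t)))"
    by (simp add: sum.If_cases)
  also have "\<dots> = mat_trace (\<sigma> sga_one)"
    unfolding sga_one_def[abs_def] by (rule rep_trace_sum[OF irreducible_repD[OF \<sigma>] finite, symmetric])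
  also have "\<dots> = of_nat (rep_dim \<sigma>)" by (simp add: rep_one[OF \<sigma>] mat_trace_def)
  finally show ?thesis .
qed

lemma sum_list_by_multiplicity:
  fixes h :: "'b \<Rightarrow> complex"
  assumes "finite A" "set xs \<subseteq> A"
  shows "(\<Sum>x\<leftarrow>xs. h x) = (\<Sum>x\<in>A. of_nat (count_list xs x) * h x)"
  using assms(2)
proof (induction xs)
  case (Cons a xs)
  have "(\<Sum>x\<in>A. of_nat (count_list (a # xs) x) * h x)
    = (\<Sum>x\<in>A. of_nat (count_list xs x) * h x + (if a = x then h x else 0))"
    by (intro sum.cong refl) (simp add: distrib_right)
  also have "\<dots> = (\<Sum>x\<in>A. of_nat (count_list xs x) * h x) + h a"
    using Cons.prems assms(1) by (simp add: sum.distrib)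
  finally show ?case using Cons by simp
qed simp

text \<open>The regular character is a sum of irreducible characters, which may be taken from \<open>X\<close>. Pairing
  both sides with \<open>\<chi>\<^sub>\<sigma>\<close> for \<open>\<sigma> \<in> X\<close> gives the multiplicity of \<open>\<sigma>\<close> on one side and \<open>d\<^sub>\<sigma>\<close> on the
  other. In particular all of \<open>X\<close> occurs, and \<open>X\<close> is finite; otherwise the sum over \<open>X\<close> would be
  \<open>0\<close> by convention.\<close>

lemma regular_character:
  fixes X :: "'a::{finite, inverse_semigroup} rep set"
  assumes X: "complete_irreps X"
  shows "(\<Sum>\<rho>\<in>X. of_nat (rep_dim \<rho>) * mat_trace (\<rho> f)) = (\<Sum>y\<in>UNIV. zeta f (sg_ran y))"
proof -
  obtain R :: "'a rep" where R: "representation R" "\<And>f. mat_trace (R f) = (\<Sum>y\<in>UNIV. zeta f (sg_ran y))"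
    by (rule regular_representation) blast
  obtain \<tau>s where \<tau>s: "\<forall>\<tau>\<in>set \<tau>s. irreducible_rep \<tau>" "\<forall>f. mat_trace (R f) = (\<Sum>\<tau>\<leftarrow>\<tau>s. mat_trace (\<tau> f))"
    using trace_decomposition[OF R(1)] by blast
  have irr: "irreducible_rep \<rho>" if "\<rho> \<in> X" for \<rho> using X that by (simp add: complete_irreps_def)
  have "\<exists>\<rho>. \<rho> \<in> X \<and> equivalent_rep \<tau> \<rho>" if "irreducible_rep \<tau>" for \<tau>
    using X that unfolding complete_irreps_def by blast
  then obtain c where c: "\<And>\<tau>. irreducible_rep \<tau> \<Longrightarrow> c \<tau> \<in> X" "\<And>\<tau>. irreducible_rep \<tau> \<Longrightarrow> equivalent_rep \<tau> (c \<tau>)"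
    by metis
  define \<rho>s where "\<rho>s = map c \<tau>s"
  have \<rho>s: "set \<rho>s \<subseteq> X" using \<tau>s(1) c(1) by (auto simp: \<rho>s_def)
  have trace: "(\<Sum>y\<in>UNIV. zeta f (sg_ran y)) = (\<Sum>\<rho>\<in>set \<rho>s. of_nat (count_list \<rho>s \<rho>) * mat_trace (\<rho> f))" for f
  proof -
    have "(\<Sum>y\<in>UNIV. zeta f (sg_ran y)) = (\<Sum>\<tau>\<leftarrow>\<tau>s. mat_trace (\<tau> f))" using R(2) \<tau>s(2) by simp
    also have "\<dots> = (\<Sum>\<tau>\<leftarrow>\<tau>s. mat_trace (c \<tau> f))"
      using \<tau>s(1) equivalent_rep_trace[OF c(2)] by (intro arg_cong[where f = sum_list] map_cong) auto
    also have "\<dots> = (\<Sum>\<rho>\<leftarrow>\<rho>s. mat_trace (\<rho> f))" by (simp add: \<rho>s_def comp_def)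
    also have "\<dots> = (\<Sum>\<rho>\<in>set \<rho>s. of_nat (count_list \<rho>s \<rho>) * mat_trace (\<rho> f))"
      by (rule sum_list_by_multiplicity) auto
    finally show ?thesis .
  qed
  have mult: "of_nat (rep_dim \<sigma>) = (of_nat (count_list \<rho>s \<sigma>) :: complex)" if \<sigma>: "\<sigma> \<in> X" for \<sigma>
  proof -
    let ?p = "\<lambda>\<rho>. \<Sum>t\<in>UNIV. mat_trace (\<rho> (groupoid_basis t)) * mat_trace (\<sigma> (groupoid_basis (sg_inv t))) / rclass_size t"
    have p: "?p \<rho> = (if \<rho> = \<sigma> then 1 else 0)" if "\<rho> \<in> set \<rho>s" for \<rho>
    proof (cases "\<rho> = \<sigma>")
      case True
      then show ?thesis using character_orthogonality(2)[OF irr[OF \<sigma>] irr[OF \<sigma>]] by simp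
    next
      case False
      have \<rho>: "\<rho> \<in> X" using that \<rho>s by blast
      have "\<not> equivalent_rep \<rho> \<sigma>"
        using X irr[OF \<rho>] \<rho> \<sigma> False equivalent_rep_refl[OF irreducible_repD[OF irr[OF \<rho>]]]
        unfolding complete_irreps_def by blast
      then show ?thesis using character_orthogonality(1)[OF irr[OF \<rho>] irr[OF \<sigma>]] False by simp
    qed
    have "of_nat (rep_dim \<sigma>) = (\<Sum>t\<in>UNIV. (\<Sum>y\<in>UNIV. zeta (groupoid_basis t) (sg_ran y))
      * mat_trace (\<sigma> (groupoid_basis (sg_inv t))) / rclass_size t)"
      by (rule regular_character_pairing[OF irr[OF \<sigma>], symmetric])
    also have "\<dots> = (\<Sum>t\<in>UNIV. \<Sum>\<rho>\<in>set \<rho>s. of_nat (count_list \<rho>s \<rho>) *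
        (mat_trace (\<rho> (groupoid_basis t)) * mat_trace (\<sigma> (groupoid_basis (sg_inv t))) / rclass_size t))"
      unfolding trace by (simp add: sum_distrib_right sum_divide_distrib mult.assoc)
    also have "\<dots> = (\<Sum>\<rho>\<in>set \<rho>s. of_nat (count_list \<rho>s \<rho>) * ?p \<rho>)"
      unfolding sum_distrib_left by (rule sum.swap)
    also have "\<dots> = (\<Sum>\<rho>\<in>set \<rho>s. if \<rho> = \<sigma> then of_nat (count_list \<rho>s \<rho>) else 0)"
      by (intro sum.cong refl) (simp add: p)
    also have "\<dots> = of_nat (count_list \<rho>s \<sigma>)" by (simp add: count_notin)
    finally show ?thesis .
  qed
  have "X \<subseteq> set \<rho>s"
  proof
    fix \<sigma> assume \<sigma>: "\<sigma> \<in> X"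
    then have "count_list \<rho>s \<sigma> \<noteq> 0" using mult[OF \<sigma>] irreducible_dim_pos[OF irr[OF \<sigma>]] by auto
    then show "\<sigma> \<in> set \<rho>s" using count_notin by metis
  qed
  then have "X = set \<rho>s" using \<rho>s by blast
  then show ?thesis unfolding trace by (intro sum.cong) (simp_all add: mult)
qed

section \<open>Counting in a D-class and the inversion formula\<close>

lemma equiv_D_rel: "equiv UNIV (D_rel :: ('a::inverse_semigroup \<times> 'a) set)"
proof (rule equivI)
  show "D_rel \<subseteq> UNIV \<times> UNIV" by simp
  show "refl (D_rel :: ('a \<times> 'a) set)"
    by (rule refl_onI) (auto simp: D_rel_def intro!: exI[of _ "sg_ran x" for x] simp: dom_idem ran_idem)
  show "sym (D_rel :: ('a \<times> 'a) set)"
  proof (rule symI)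
    fix s t :: 'a assume "(s, t) \<in> D_rel"
    then obtain x where "sg_dom x = sg_ran s" "sg_ran x = sg_ran t" by (auto simp: D_rel_def)
    then have "sg_dom (sg_inv x) = sg_ran t \<and> sg_ran (sg_inv x) = sg_ran s" by simp
    then show "(t, s) \<in> D_rel" unfolding D_rel_def by blast
  qed
  show "trans (D_rel :: ('a \<times> 'a) set)"
  proof (rule transI)
    fix s t u :: 'a assume "(s, t) \<in> D_rel" "(t, u) \<in> D_rel"
    then obtain x y where "sg_dom x = sg_ran s" "sg_ran x = sg_ran t" "sg_dom y = sg_ran t" "sg_ran y = sg_ran u"
      by (auto simp: D_rel_def)
    then have "sg_dom (y * x) = sg_ran s \<and> sg_ran (y * x) = sg_ran u" by (simp add: dom_comp ran_comp)
    then show "(s, u) \<in> D_rel" unfolding D_rel_def by blast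
  qed
qed

lemma rclass_size_Drel: "(s, t) \<in> D_rel \<Longrightarrow> rclass_size s = rclass_size t"
  unfolding D_rel_def using rclass_size_transport by blast

lemma bij_betw_right_mult:
  fixes x :: "'a::inverse_semigroup"
  shows "bij_betw (\<lambda>u. u * x) {u. sg_ran u = e \<and> sg_dom u = sg_ran x} {u. sg_ran u = e \<and> sg_dom u = sg_dom x}"
proof (rule bij_betw_byWitness[where f' = "\<lambda>u. u * sg_inv x"])
  show "\<forall>u\<in>{u. sg_ran u = e \<and> sg_dom u = sg_ran x}. u * x * sg_inv x = u"
  proof
    fix u assume "u \<in> {u. sg_ran u = e \<and> sg_dom u = sg_ran x}"
    then show "u * x * sg_inv x = u" using mult_dom[of u] by (simp add: mult.assoc sg_ran_def)
  qed
  show "\<forall>u\<in>{u. sg_ran u = e \<and> sg_dom u = sg_dom x}. u * sg_inv x * x = u"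
  proof
    fix u assume "u \<in> {u. sg_ran u = e \<and> sg_dom u = sg_dom x}"
    then show "u * sg_inv x * x = u" using mult_dom[of u] by (simp add: mult.assoc sg_dom_def)
  qed
qed (auto simp: dom_comp ran_comp)

text \<open>The elements with range \<open>e\<close> are sorted by their domain \<open>f\<close>, an idempotent \<open>\<D>\<close>-related to \<open>e\<close>.
  Right multiplication by an \<open>x\<close> with domain \<open>e\<close> and range \<open>f\<close> maps each fibre bijectively onto the
  maximal subgroup at \<open>e\<close>.\<close>

lemma rclass_size_eq:
  fixes C :: "'a::{finite, inverse_semigroup} set"
  assumes C: "C \<in> UNIV // D_rel" and e: "e \<in> C" "idem e"
  shows "rclass_size e = of_nat (card {x \<in> C. idem x}) * of_nat (card (maximal_subgroup e))"
proof -
  have dom_C: "sg_dom u \<in> C" if "sg_ran u = e" for u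
  proof -
    have "sg_dom (sg_inv u) = sg_ran e \<and> sg_ran (sg_inv u) = sg_ran (sg_dom u)"
      using that e by (simp add: ran_idem)
    then have "(e, sg_dom u) \<in> D_rel" unfolding D_rel_def by blast
    then show ?thesis using in_quotient_imp_closed[OF equiv_D_rel C e(1)] by blast
  qed
  have fibre: "card {u. sg_ran u = e \<and> sg_dom u = f} = card (maximal_subgroup e)" if f: "f \<in> C" "idem f" for f
  proof -
    have "(e, f) \<in> D_rel" using in_quotient_imp_in_rel[OF equiv_D_rel C, of e f] e f by simp
    then obtain x where "sg_dom x = e" "sg_ran x = f"
      using e f by (auto simp: D_rel_def ran_idem)
    then have "card {u. sg_ran u = e \<and> sg_dom u = f} = card {u. sg_ran u = e \<and> sg_dom u = e}"
      using bij_betw_same_card[OF bij_betw_right_mult[where e = e and x = x]] by simp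
    also have "{u. sg_ran u = e \<and> sg_dom u = e} = maximal_subgroup e"
      by (auto simp: maximal_subgroup_def)
    finally show ?thesis .
  qed
  have "card {u. sg_ran u = e} = (\<Sum>u\<in>{u. sg_ran u = e}. 1)" by simp
  also have "\<dots> = (\<Sum>f\<in>{x \<in> C. idem x}. \<Sum>u\<in>{u \<in> {u. sg_ran u = e}. sg_dom u = f}. 1)"
    by (rule sum.group[symmetric]) (use dom_C in auto)
  also have "\<dots> = (\<Sum>f\<in>{x \<in> C. idem x}. card (maximal_subgroup e))"
    by (intro sum.cong refl) (simp add: fibre)
  finally show ?thesis using e by (simp add: rclass_size_def ran_idem)
qed

theorem theorem3p4:
  fixes D :: "nat \<Rightarrow> 'a::{finite, inverse_semigroup} set"
    and e :: "nat \<Rightarrow> 'a"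
    and r :: "nat \<Rightarrow> nat"
    and G :: "nat \<Rightarrow> 'a set"
    and n k :: nat
    and \<X> :: "'a rep set"
    and g :: "'a \<Rightarrow> complex"
    and c :: "'a \<Rightarrow> complex"
    and s :: 'a
  assumes "bij_betw D {0..n} (UNIV // D_rel)"
    and "\<And>j. j \<le> n \<Longrightarrow> r j = card {x \<in> D j. idem x}"
    and "\<And>j. j \<le> n \<Longrightarrow> e j \<in> D j \<and> idem (e j)"
    and "\<And>j. j \<le> n \<Longrightarrow> G j = maximal_subgroup (e j)"
    and "complete_irreps \<X>"
    and "g = (\<lambda>u. \<Sum>t\<in>UNIV. c t * groupoid_basis t u)"
    and "k \<le> n" and "s \<in> D k"
  shows "c s = 1 / (of_nat (r k) * of_nat (card (G k))) *
           (\<Sum>\<rho>\<in>\<X>. of_nat (rep_dim \<rho>) * mat_trace (\<rho> g * \<rho> (groupoid_basis (sg_inv s))))"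
proof -
  have C: "D k \<in> UNIV // D_rel" using assms(1,7) by (auto dest: bij_betwE)
  have e: "e k \<in> D k" "idem (e k)" using assms(3,7) by auto
  \<comment> \<open>The denominator is the number of elements with the range of \<open>s\<close>, for any choice of \<open>e k\<close>.\<close>
  have "(s, e k) \<in> D_rel"
    using in_quotient_imp_in_rel[OF equiv_D_rel C, of s "e k"] e(1) assms(8) by simp
  then have size: "of_nat (r k) * of_nat (card (G k)) = rclass_size s"
    using rclass_size_eq[OF C e] rclass_size_Drel[of s "e k"] assms(2,4,7) by simp
  have zeta_g: "zeta g w = c w" for w
    unfolding assms(6) zeta_sum zeta_groupoid_basis by (simp add: if_distrib[of "(*) _"] cong: if_cong)
  let ?h = "sga_mult g (groupoid_basis (sg_inv s))"
  have zeta_h: "zeta ?h w = (if sg_ran s = sg_dom w then c (w * s) else 0)" for w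
  proof -
    have "zeta ?h w = (\<Sum>v | sg_dom v = sg_dom w. if v = sg_inv s then c (w * s) else 0)"
      unfolding zeta_sga_mult zeta_g zeta_groupoid_basis by (intro sum.cong refl) auto
    then show ?thesis by simp
  qed
  have "(\<Sum>\<rho>\<in>\<X>. of_nat (rep_dim \<rho>) * mat_trace (\<rho> g * \<rho> (groupoid_basis (sg_inv s))))
    = (\<Sum>\<rho>\<in>\<X>. of_nat (rep_dim \<rho>) * mat_trace (\<rho> ?h))"
    using assms(5) by (intro sum.cong refl) (simp add: complete_irreps_def irreducible_rep_def representationD(4))
  also have "\<dots> = (\<Sum>y\<in>UNIV. zeta ?h (sg_ran y))" by (rule regular_character[OF assms(5)])
  also have "\<dots> = (\<Sum>y\<in>UNIV. if sg_ran y = sg_ran s then c s else 0)"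
    by (intro sum.cong refl) (auto simp: zeta_h dom_idem)
  also have "\<dots> = rclass_size s * c s" by (simp add: sum.If_cases rclass_size_def)
  finally show ?thesis unfolding size using rclass_size_nz[of s] by simp
qed

end
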